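(* Let $T\in S^3\mathbb{C}^m\subset\mathbb{C}^m\otimes\mathbb{C}^m\otimes\mathbb{C}^m$ be $1$-generic and maximally symmetric compressible. Then, up to isomorphism, $T$ is one of: (1) $T_{m-1,CW}$; (2) $\tilde T_{m-2,CW}$; (3) $T=a_1(a_1^2+\cdots+a_m^2)$, where $a_1,\dots,a_m$ is a basis of $\mathbb{C}^m$; as a subspace of $\mathbb{C}^m\otimes\mathbb{C}^m$ this is (in suitable bases) $$\begin{pmatrix} x_1&x_2&x_3&\cdots&x_m\\ x_2&x_1&0&\cdots&0\\ x_3&0&x_1&&\\ \vdots&\vdots&&\ddots&\\ x_m&0&&&x_1\end{pmatrix},\qquad x_1,\dots,x_m\in\mathbb{C}.$$ In particular, up to isomorphism, the only $1$-generic, maximally symmetric compressible tensor of minimal border rank (border rank $m$) in $\mathbb{C}^m\otimes\mathbb{C}^m\otimes\mathbb{C}^m$ is $\tilde T_{m-2,CW}$.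
   Context: All vector spaces are over $\mathbb{C}$. A tensor $T\in A\otimes B\otimes C$ is viewed as a linear map $T:A^*\to B\otimes C$ (and similarly $B^*\to A\otimes C$, $C^*\to A\otimes B$); $T(A^* )$ is the corresponding subspace of $B\otimes C$. With $A,B,C$ of dimension $m$, $T$ is $1_A$-generic if $T(A^* )$ contains an element of rank $m$, similarly $1_B$-, $1_C$-generic, and $T$ is $1$-generic if it is $1_A$-, $1_B$- and $1_C$-generic. Border rank of $T$: the least $r$ such that $T$ is a limit of tensors that are sums of $r$ tensors of the form $a\otimes b\otimes c$. $S^3\mathbb{C}^m$ denotes the symmetric tensors in $(\mathbb{C}^m)^{\otimes 3}$, identified with homogeneous cubic polynomials on $(\mathbb{C}^m)^*$. A tensor $T\in S^3A\subset A\otimes A\otimes A$ is maximally symmetric compressible if there is a hyperplane $H_A\subset A^*$ with $T|_{H_A\times H_A\times H_A}=0$. Two tensors are isomorphic if they agree up to the action of $GL_m\times GL_m\times GL_m$ and permutation of the three factors. The Coppersmith-Winograd tensors are $$T_{q,CW}=\sum_{j=1}^q (a_0\otimes b_j\otimes c_j+a_j\otimes b_0\otimes c_j+a_j\otimes b_j\otimes c_0)\in(\mathbb{C}^{q+1})^{\otimes3},$$ $$\tilde T_{q,CW}=\sum_{j=1}^q (a_0\otimes b_j\otimes c_j+a_j\otimes b_0\otimes c_j+a_j\otimes b_j\otimes c_0)+a_0\otimes b_0\otimes c_{q+1}+a_0\otimes b_{q+1}\otimes c_0+a_{q+1}\otimes b_0\otimes c_0\in(\mathbb{C}^{q+2})^{\otimes3},$$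 with $\{a_j\},\{b_j\},\{c_j\}$ bases of the factors.
   Formalization: The uniqueness of the minimal border rank tensor is claimed only for m ≥ 3: for m = 2 the tensor a_1(a_1^2+a_2^2) also has border rank 2 and is not isomorphic to the Coppersmith-Winograd tensor, and for m = 1 that tensor is undefined; case (2) likewise requires m ≥ 2. *)

theory Defs
  imports "HOL-Analysis.Analysis"
begin

text \<open>
  The space \<open>\<complex>\<^sup>m\<close> is \<open>complex^'n\<close> with \<open>m = CARD('n)\<close>, and a tensor in \<open>\<complex>\<^sup>m \<otimes> \<complex>\<^sup>m \<otimes> \<complex>\<^sup>m\<close>
  is its coordinate array in \<open>complex^'n^'n^'n\<close>. The dual space is again \<open>complex^'n\<close>, by
  coordinates in the dual of the standard basis. Linear algebra over the complex numbers uses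
  the constants prefixed by \<open>vec\<close> (the unprefixed ones are over the reals).
\<close>

type_synonym 'n tensor3 = "complex^'n^'n^'n"

definition is_basis :: "nat set \<Rightarrow> (nat \<Rightarrow> complex^'n) \<Rightarrow> bool" where
  "is_basis I a \<longleftrightarrow> inj_on a I \<and> vec.independent (a ` I) \<and> vec.span (a ` I) = UNIV"

definition tensor_prod :: "complex^'n \<Rightarrow> complex^'n \<Rightarrow> complex^'n \<Rightarrow> 'n tensor3" where
  "tensor_prod a b c = (\<chi> i j k. a $ i * b $ j * c $ k)"

text \<open>The flattenings \<open>A\<^sup>* \<rightarrow> B \<otimes> C\<close>, \<open>B\<^sup>* \<rightarrow> A \<otimes> C\<close>, \<open>C\<^sup>* \<rightarrow> A \<otimes> B\<close>.\<close>

definition flat_A :: "'n::finite tensor3 \<Rightarrow> complex^'n \<Rightarrow> complex^'n^'n" where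
  "flat_A T \<alpha> = (\<chi> j k. \<Sum>i\<in>UNIV. \<alpha> $ i * T $ i $ j $ k)"

definition flat_B :: "'n::finite tensor3 \<Rightarrow> complex^'n \<Rightarrow> complex^'n^'n" where
  "flat_B T \<beta> = (\<chi> i k. \<Sum>j\<in>UNIV. \<beta> $ j * T $ i $ j $ k)"

definition flat_C :: "'n::finite tensor3 \<Rightarrow> complex^'n \<Rightarrow> complex^'n^'n" where
  "flat_C T \<gamma> = (\<chi> i j. \<Sum>k\<in>UNIV. \<gamma> $ k * T $ i $ j $ k)"

definition one_A_generic :: "'n::finite tensor3 \<Rightarrow> bool" where
  "one_A_generic T \<longleftrightarrow> (\<exists>M \<in> range (flat_A T). rank M = CARD('n))"

definition one_B_generic :: "'n::finite tensor3 \<Rightarrow> bool" where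
  "one_B_generic T \<longleftrightarrow> (\<exists>M \<in> range (flat_B T). rank M = CARD('n))"

definition one_C_generic :: "'n::finite tensor3 \<Rightarrow> bool" where
  "one_C_generic T \<longleftrightarrow> (\<exists>M \<in> range (flat_C T). rank M = CARD('n))"

definition one_generic :: "'n::finite tensor3 \<Rightarrow> bool" where
  "one_generic T \<longleftrightarrow> one_A_generic T \<and> one_B_generic T \<and> one_C_generic T"

definition sums_of_rank_one :: "nat \<Rightarrow> ('n::finite tensor3) set" where
  "sums_of_rank_one r = {\<Sum>s<r. tensor_prod (a s) (b s) (c s) | a b c. True}"

definition border_rank :: "'n::finite tensor3 \<Rightarrow> nat" where
  "border_rank T = (LEAST r. T \<in> closure (sums_of_rank_one r))"

definition symmetric_tensor :: "'n::finite tensor3 \<Rightarrow> bool" where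
  "symmetric_tensor T \<longleftrightarrow>
     (\<forall>i j k. T $ i $ j $ k = T $ j $ i $ k \<and> T $ i $ j $ k = T $ i $ k $ j)"

definition trilinear_form ::
  "'n::finite tensor3 \<Rightarrow> complex^'n \<Rightarrow> complex^'n \<Rightarrow> complex^'n \<Rightarrow> complex" where
  "trilinear_form T \<alpha> \<beta> \<gamma> =
     (\<Sum>i\<in>UNIV. \<Sum>j\<in>UNIV. \<Sum>k\<in>UNIV. \<alpha> $ i * \<beta> $ j * \<gamma> $ k * T $ i $ j $ k)"

definition hyperplane :: "(complex^'n::finite) set \<Rightarrow> bool" where
  "hyperplane H \<longleftrightarrow> vec.subspace H \<and> vec.dim H + 1 = CARD('n)"

definition max_sym_compressible :: "'n::finite tensor3 \<Rightarrow> bool" where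
  "max_sym_compressible T \<longleftrightarrow> symmetric_tensor T \<and>
     (\<exists>H. hyperplane H \<and> (\<forall>\<alpha>\<in>H. \<forall>\<beta>\<in>H. \<forall>\<gamma>\<in>H. trilinear_form T \<alpha> \<beta> \<gamma> = 0))"

definition gl_act ::
  "complex^'n^'n \<Rightarrow> complex^'n^'n \<Rightarrow> complex^'n^'n \<Rightarrow> 'n::finite tensor3 \<Rightarrow> 'n tensor3" where
  "gl_act P Q R T = (\<chi> i j k. \<Sum>i'\<in>UNIV. \<Sum>j'\<in>UNIV. \<Sum>k'\<in>UNIV.
     P $ i $ i' * Q $ j $ j' * R $ k $ k' * T $ i' $ j' $ k')"

definition factor_permutations :: "'n::finite tensor3 \<Rightarrow> ('n tensor3) set" where
  "factor_permutations T =
     {(\<chi> i j k. T $ i $ j $ k), (\<chi> i j k. T $ i $ k $ j), (\<chi> i j k. T $ j $ i $ k),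
      (\<chi> i j k. T $ j $ k $ i), (\<chi> i j k. T $ k $ i $ j), (\<chi> i j k. T $ k $ j $ i)}"

definition tensor_isomorphic :: "'n::finite tensor3 \<Rightarrow> 'n tensor3 \<Rightarrow> bool" where
  "tensor_isomorphic T T' \<longleftrightarrow>
     (\<exists>P Q R. \<exists>S \<in> factor_permutations T'.
        invertible P \<and> invertible Q \<and> invertible R \<and> T = gl_act P Q R S)"

definition cw_tensor ::
  "nat \<Rightarrow> (nat \<Rightarrow> complex^'n) \<Rightarrow> (nat \<Rightarrow> complex^'n) \<Rightarrow> (nat \<Rightarrow> complex^'n) \<Rightarrow> 'n::finite tensor3"
  where
  "cw_tensor q a b c =
     (\<Sum>j=1..q. tensor_prod (a 0) (b j) (c j) + tensor_prod (a j) (b 0) (c j)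
               + tensor_prod (a j) (b j) (c 0))"

definition cw_tilde_tensor ::
  "nat \<Rightarrow> (nat \<Rightarrow> complex^'n) \<Rightarrow> (nat \<Rightarrow> complex^'n) \<Rightarrow> (nat \<Rightarrow> complex^'n) \<Rightarrow> 'n::finite tensor3"
  where
  "cw_tilde_tensor q a b c =
     (\<Sum>j=1..q. tensor_prod (a 0) (b j) (c j) + tensor_prod (a j) (b 0) (c j)
               + tensor_prod (a j) (b j) (c 0))
     + tensor_prod (a 0) (b 0) (c (q+1)) + tensor_prod (a 0) (b (q+1)) (c 0)
     + tensor_prod (a (q+1)) (b 0) (c 0)"

text \<open>
  The product \<open>uvw\<close> in \<open>S\<^sup>3\<complex>\<^sup>m\<close>, normalised so that \<open>uuu = u \<otimes> u \<otimes> u\<close>: the symmetric tensor whose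
  trilinear form restricts on the diagonal \<open>(\<alpha>, \<alpha>, \<alpha>)\<close> to the cubic polynomial \<open>u(\<alpha>) v(\<alpha>) w(\<alpha>)\<close>.
\<close>

definition sym_prod :: "complex^'n \<Rightarrow> complex^'n \<Rightarrow> complex^'n \<Rightarrow> 'n::finite tensor3" where
  "sym_prod u v w = (1/6) *\<^sub>R
     (tensor_prod u v w + tensor_prod u w v + tensor_prod v u w
      + tensor_prod v w u + tensor_prod w u v + tensor_prod w v u)"

text \<open>The cubic \<open>a\<^sub>1 (a\<^sub>1\<^sup>2 + \<dots> + a\<^sub>m\<^sup>2)\<close>.\<close>

definition linear_times_quadric :: "nat \<Rightarrow> (nat \<Rightarrow> complex^'n) \<Rightarrow> 'n::finite tensor3" where
  "linear_times_quadric m a = (\<Sum>j=1..m. sym_prod (a 1) (a j) (a j))"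

text \<open>
  Entry \<open>(p, q)\<close>, for \<open>1 \<le> p, q \<le> m\<close>, of the matrix with \<open>x\<^sub>1\<close> on the diagonal,
  \<open>x\<^sub>1, \<dots>, x\<^sub>m\<close> in the first row and in the first column, and zeros elsewhere.
\<close>

definition arrow_entry :: "(nat \<Rightarrow> complex) \<Rightarrow> nat \<Rightarrow> nat \<Rightarrow> complex" where
  "arrow_entry x p q =
     (if p = q then x 1 else if p = 1 then x q else if q = 1 then x p else 0)"

text \<open>The element of \<open>B \<otimes> C\<close> with matrix \<open>D\<close> in the bases \<open>f\<^sub>1, \<dots>, f\<^sub>m\<close> of \<open>B\<close> and \<open>g\<^sub>1, \<dots>, g\<^sub>m\<close> of \<open>C\<close>.\<close>

definition matrix_in_bases ::
  "nat \<Rightarrow> (nat \<Rightarrow> complex^'n) \<Rightarrow> (nat \<Rightarrow> complex^'n) \<Rightarrow> (nat \<Rightarrow> nat \<Rightarrow> complex)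
   \<Rightarrow> complex^'n^'n" where
  "matrix_in_bases m f g D = (\<chi> j k. \<Sum>p=1..m. \<Sum>q=1..m. D p q * f p $ j * g q $ k)"

end

theory Submission
  imports Defs
begin

text \<open>
  Let \<open>T\<close> vanish on \<open>H = ker l\<close>, so the cubic is \<open>l q\<close>, and take a maximal orthonormal family
  \<open>e\<^sub>1, \<dots>, e\<^sub>r\<close> of \<open>q\<close> in \<open>H\<close>. Its orthogonal complement in \<open>H\<close> is the radical of \<open>q\<close> on \<open>H\<close>, and
  1-genericity makes this radical at most a line. If it is zero, then in suitable coordinates
  \<open>T = x\<^sub>0 (c x\<^sub>0\<^sup>2 + x\<^sub>1\<^sup>2 + \<dots> + x\<^sub>r\<^sup>2)\<close> up to scaling, which is case (1) or (3) according to whether \<open>c\<close>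
  vanishes; if it is a line, then \<open>T\<close> is case (2). For \<open>m \<ge> 3\<close>, Strassen's equations fail on the first
  normal form for every \<open>c\<close>, so cases (1) and (3) have border rank above \<open>m\<close>.
\<close>

section \<open>Dual bases and trilinear forms\<close>

text \<open>The form \<open>q\<close> on \<open>H\<close> is read off the tensor as
  \<open>trilinear_form T v\<close> for a vector \<open>v\<close> outside \<open>H\<close>. Adding
  an element of \<open>H\<close> to \<open>v\<close> does not change this form on \<open>H\<close>,
  because \<open>T\<close> vanishes there, so \<open>v\<close> stays free for further normalisation.
  The radical is at most a line for the following reason: a radical vector \<open>w\<close> with
  \<open>trilinear_form T v v w = 0\<close> is killed by every flattening, since each of the other
  two arguments splits into a multiple of \<open>v\<close> and a vector of \<open>H\<close>. Hence
  the functional \<open>trilinear_form T v v\<close> is injective on the radical as soon as one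
  flattening is invertible. The functionals dual to the normalised vectors form a basis in which
  \<open>T\<close> is equal to its normal form, so that no isomorphism has to be
  constructed.\<close>

lemma scalar_product_add_left: "scalar_product (x + y) z = scalar_product x z + scalar_product y z"
  and scalar_product_add_right: "scalar_product z (x + y) = scalar_product z x + scalar_product z y"
  and scalar_product_scale_left: "scalar_product (k *s x) z = k * scalar_product x z"
  and scalar_product_scale_right: "scalar_product z (k *s x) = k * scalar_product z x"
  and scalar_product_commute: "scalar_product x z = scalar_product z x"
  and scalar_product_zero [simp]: "scalar_product 0 z = 0" "scalar_product z 0 = 0"
  for x y z :: "'a::comm_ring_1^'n::finite"
  by (simp_all add: scalar_product_def algebra_simps sum.distrib sum_distrib_left)

lemma scalar_product_diff_right: "scalar_product z (x - y) = scalar_product z x - scalar_product z y"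
  for x y z :: "'a::comm_ring_1^'n::finite"
  by (simp add: scalar_product_def algebra_simps sum_subtractf)

lemma scalar_product_sum_right:
  "scalar_product z (\<Sum>i\<in>I. f i) = (\<Sum>i\<in>I. scalar_product z (f i))"
  for z :: "'a::comm_ring_1^'n::finite"
  by (induction I rule: infinite_finite_induct) (simp_all add: scalar_product_add_right)

lemmas scalar_product_simps = scalar_product_add_left scalar_product_add_right
  scalar_product_scale_left scalar_product_scale_right scalar_product_diff_right
  scalar_product_sum_right

lemma scalar_product_axis_right: "scalar_product x (axis i 1) = x $ i"
  for x :: "'a::comm_ring_1^'n::finite"
  by (simp add: scalar_product_def axis_def if_distrib sum.delta cong: if_cong)

lemma scalar_product_eq_0: "(\<And>x. scalar_product x y = 0) \<Longrightarrow> y = 0"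
  for y :: "'a::comm_ring_1^'n::finite"
  by (metis scalar_product_axis_right scalar_product_commute vec_eq_iff zero_index)

lemma is_basis_card:
  assumes "is_basis I (a :: nat \<Rightarrow> complex^'n::finite)"
  shows "card I = CARD('n)"
proof -
  have "card (a ` I) = vec.dim (UNIV :: (complex^'n) set)"
    using assms unfolding is_basis_def by (metis vec.dim_eq_card vec.span_UNIV)
  then show ?thesis
    using assms by (metis is_basis_def card_image vec_dim_card)
qed

text \<open>\<open>scalar_product\<close> has no conjugation, so it is the evaluation pairing of the
  space with its dual, both being the same type. Only biorthogonality is recorded: independence
  follows from it, and spanning follows once the cardinality matches the dimension.\<close>

definition dual_families :: "nat set \<Rightarrow> (nat \<Rightarrow> complex^'n::finite) \<Rightarrow> (nat \<Rightarrow> complex^'n) \<Rightarrow> bool" where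
  "dual_families I a e \<longleftrightarrow>
     (\<forall>i\<in>I. \<forall>j\<in>I. scalar_product (a i) (e j) = (if i = j then 1 else 0))"

lemma dual_families_sym: "dual_families I a e \<Longrightarrow> dual_families I e a"
  by (auto simp: dual_families_def scalar_product_commute[of "e _"])

lemma dual_families_independent:
  assumes "finite I" "dual_families I a e"
  shows "inj_on e I" "vec.independent (e ` I)"
proof -
  have d: "scalar_product (a i) (e j) = (if i = j then 1 else 0)" if "i \<in> I" "j \<in> I" for i j
    using assms(2) that unfolding dual_families_def by auto
  show inj: "inj_on e I"
    by (rule inj_onI) (metis d zero_neq_one)
  show "vec.independent (e ` I)"
  proof (rule vec.independent_if_scalars_zero)
    fix f x
    assume s: "(\<Sum>x\<in>e ` I. f x *s x) = 0" and "x \<in> e ` I"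
    then obtain i where i: "i \<in> I" "x = e i" by auto
    have "0 = scalar_product (a i) (\<Sum>j\<in>I. f (e j) *s e j)"
      using s by (simp add: sum.reindex[OF inj])
    also have "\<dots> = (\<Sum>j\<in>I. if i = j then f (e j) else 0)"
      unfolding scalar_product_sum_right scalar_product_scale_right
      by (rule sum.cong) (auto simp: d i)
    also have "\<dots> = f x" using i assms(1) by (simp add: sum.delta)
    finally show "f x = 0" by simp
  qed (use assms in simp)
qed

lemma dual_families_is_basis:
  assumes "finite I" "dual_families I a (e :: nat \<Rightarrow> complex^'n::finite)" "card I = CARD('n)"
  shows "is_basis I e"
proof -
  note i = dual_families_independent[OF assms(1,2)]
  have "UNIV \<subseteq> vec.span (e ` I)"
    by (rule vec.card_ge_dim_independent) (use i assms in \<open>simp_all add: card_image card_cart_basis\<close>)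
  with i show ?thesis unfolding is_basis_def by auto
qed

text \<open>A basis written as the rows of a square matrix makes that matrix invertible, and the
  columns of the inverse are the dual basis; \<open>h\<close> matches the index set with the
  coordinate type.\<close>

lemma is_basis_dual:
  assumes a: "is_basis I (a :: nat \<Rightarrow> complex^'n::finite)" and fin: "finite I"
  obtains e where "is_basis I e" "dual_families I a e"
proof -
  obtain h where h: "bij_betw h I (UNIV :: 'n set)"
    using finite_same_card_bij[OF fin finite is_basis_card[OF a]] by auto
  define A :: "complex^'n^'n" where "A = (\<chi> i. a (inv_into I h i))"
  have "rows A = a ` inv_into I h ` UNIV"
    by (auto simp: rows_def row_def A_def)
  also have "\<dots> = a ` I"
    using bij_betw_inv_into[OF h] by (simp add: bij_betw_def)
  finally have "vec.span (rows A) = UNIV"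
    using a by (simp add: is_basis_def)
  then obtain B where "B ** A = mat 1"
    using matrix_left_invertible_span_rows_gen by blast
  then have AB: "A ** B = mat 1"
    using matrix_left_right_inverse by blast
  define e where "e = (\<lambda>j. column (h j) B)"
  have "dual_families I a e"
    unfolding dual_families_def
  proof (intro ballI)
    fix i j assume ij: "i \<in> I" "j \<in> I"
    have "scalar_product (a i) (e j) = (A ** B) $ h i $ h j"
      using ij h by (simp add: matrix_matrix_mult_def scalar_product_def e_def column_def A_def
          bij_betw_inv_into_left)
    then show "scalar_product (a i) (e j) = (if i = j then 1 else 0)"
      using ij h by (auto simp: AB mat_def bij_betw_def inj_on_def)
  qed
  with that dual_families_is_basis[OF fin _ is_basis_card[OF a]] show thesis by blast
qed

section \<open>Trilinear forms of tensors\<close>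

lemma trilinear_form_add:
  "trilinear_form T (x + x') y z = trilinear_form T x y z + trilinear_form T x' y z"
  "trilinear_form T x (y + y') z = trilinear_form T x y z + trilinear_form T x y' z"
  "trilinear_form T x y (z + z') = trilinear_form T x y z + trilinear_form T x y z'"
  by (simp_all add: trilinear_form_def algebra_simps sum.distrib)

lemma trilinear_form_scale:
  "trilinear_form T (k *s x) y z = k * trilinear_form T x y z"
  "trilinear_form T x (k *s y) z = k * trilinear_form T x y z"
  "trilinear_form T x y (k *s z) = k * trilinear_form T x y z"
  by (simp_all add: trilinear_form_def sum_distrib_left mult_ac)

lemma trilinear_form_zero [simp]:
  "trilinear_form T 0 y z = 0" "trilinear_form T x 0 z = 0" "trilinear_form T x y 0 = 0"
  by (simp_all add: trilinear_form_def)

lemma trilinear_form_diff: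
  "trilinear_form T (x - x') y z = trilinear_form T x y z - trilinear_form T x' y z"
  "trilinear_form T x (y - y') z = trilinear_form T x y z - trilinear_form T x y' z"
  "trilinear_form T x y (z - z') = trilinear_form T x y z - trilinear_form T x y z'"
  by (simp_all add: trilinear_form_def algebra_simps sum_subtractf)

lemma trilinear_form_sum:
  "trilinear_form T (\<Sum>i\<in>I. f i) y z = (\<Sum>i\<in>I. trilinear_form T (f i) y z)"
  "trilinear_form T x (\<Sum>i\<in>I. f i) z = (\<Sum>i\<in>I. trilinear_form T x (f i) z)"
  "trilinear_form T x y (\<Sum>i\<in>I. f i) = (\<Sum>i\<in>I. trilinear_form T x y (f i))"
  by (induction I rule: infinite_finite_induct) (simp_all add: trilinear_form_add)

lemma trilinear_form_tensor_add:
  "trilinear_form (S + T) x y z = trilinear_form S x y z + trilinear_form T x y z"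
  by (simp add: trilinear_form_def algebra_simps sum.distrib)

lemma trilinear_form_tensor_sum:
  "trilinear_form (\<Sum>i\<in>I. T i) x y z = (\<Sum>i\<in>I. trilinear_form (T i) x y z)"
  by (induction I rule: infinite_finite_induct)
    (simp_all add: trilinear_form_tensor_add, simp_all add: trilinear_form_def)

lemma trilinear_form_tensor_prod:
  "trilinear_form (tensor_prod a b c) x y z =
     scalar_product a x * scalar_product b y * scalar_product c z"
proof -
  have "scalar_product a x * scalar_product b y * scalar_product c z =
      (\<Sum>i\<in>UNIV. a $ i * x $ i * (\<Sum>j\<in>UNIV. b $ j * y $ j * (\<Sum>k\<in>UNIV. c $ k * z $ k)))"
    unfolding scalar_product_def by (simp only: sum_distrib_right mult.assoc)
  also have "\<dots> = trilinear_form (tensor_prod a b c) x y z"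
    unfolding trilinear_form_def tensor_prod_def vec_lambda_beta sum_distrib_left
    by (intro sum.cong refl) (simp only: mult_ac)
  finally show ?thesis by simp
qed

lemma trilinear_form_nested:
  "trilinear_form T x y z =
     (\<Sum>i\<in>UNIV. x $ i * (\<Sum>j\<in>UNIV. y $ j * (\<Sum>k\<in>UNIV. z $ k * T $ i $ j $ k)))"
  unfolding trilinear_form_def sum_distrib_left by (simp only: mult.assoc)

lemma sum_axis: "(\<Sum>i\<in>UNIV. axis j 1 $ i * f i) = f j"
  for f :: "'n::finite \<Rightarrow> 'a::comm_ring_1"
proof -
  have "(\<Sum>i\<in>UNIV. axis j 1 $ i * f i) = (\<Sum>i\<in>UNIV. if i = j then f i else 0)"
    by (rule sum.cong) (auto simp: axis_def)
  then show ?thesis by simp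
qed

lemma trilinear_form_axis:
  "trilinear_form T (axis i 1) (axis j 1) (axis k 1) = T $ i $ j $ k"
  by (simp add: trilinear_form_nested sum_axis)

text \<open>The bridge between forms and matrices: kernels of flattenings become vanishing
  statements about the trilinear form, where symmetry is easy to use.\<close>

lemma trilinear_form_flat_A:
  "trilinear_form T x y z = scalar_product y (flat_A T x *v z)"
proof -
  have "scalar_product y (flat_A T x *v z) =
      (\<Sum>j\<in>UNIV. \<Sum>k\<in>UNIV. \<Sum>i\<in>UNIV. x $ i * y $ j * z $ k * T $ i $ j $ k)"
    unfolding scalar_product_def flat_A_def matrix_vector_mult_def vec_lambda_beta
      sum_distrib_left sum_distrib_right
    by (intro sum.cong refl) (simp only: mult_ac)
  also have "\<dots> = (\<Sum>j\<in>UNIV. \<Sum>i\<in>UNIV. \<Sum>k\<in>UNIV. x $ i * y $ j * z $ k * T $ i $ j $ k)"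
    by (rule sum.cong[OF refl]) (rule sum.swap)
  also have "\<dots> = trilinear_form T x y z"
    unfolding trilinear_form_def by (rule sum.swap)
  finally show ?thesis by simp
qed

lemma trilinear_form_swap12:
  assumes "symmetric_tensor T"
  shows "trilinear_form T x y z = trilinear_form T y x z"
proof -
  have s: "T $ i $ j $ k = T $ j $ i $ k" for i j k
    using assms by (simp add: symmetric_tensor_def)
  have "trilinear_form T x y z =
      (\<Sum>j\<in>UNIV. \<Sum>i\<in>UNIV. \<Sum>k\<in>UNIV. x $ i * y $ j * z $ k * T $ i $ j $ k)"
    unfolding trilinear_form_def by (rule sum.swap)
  also have "\<dots> = trilinear_form T y x z"
    unfolding trilinear_form_def
    by (intro sum.cong refl) (metis s mult.commute)
  finally show ?thesis .
qed

lemma trilinear_form_swap23: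
  assumes "symmetric_tensor T"
  shows "trilinear_form T x y z = trilinear_form T x z y"
proof -
  have s: "T $ i $ j $ k = T $ i $ k $ j" for i j k
    using assms by (simp add: symmetric_tensor_def)
  have "trilinear_form T x y z =
      (\<Sum>i\<in>UNIV. \<Sum>k\<in>UNIV. \<Sum>j\<in>UNIV. x $ i * y $ j * z $ k * T $ i $ j $ k)"
    unfolding trilinear_form_def by (rule sum.cong[OF refl]) (rule sum.swap)
  also have "\<dots> = trilinear_form T x z y"
    unfolding trilinear_form_def
    by (intro sum.cong refl) (metis s mult.commute mult.assoc)
  finally show ?thesis .
qed

text \<open>Trilinearity extends the equality from the basis to its span, one argument at a time.
  The normal forms are identified this way, by evaluation on the basis dual to the one that defines
  them.\<close>

lemma tensor_eq_on_basis:
  assumes e: "is_basis I e"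
    and eq: "\<And>i j k. i \<in> I \<Longrightarrow> j \<in> I \<Longrightarrow> k \<in> I \<Longrightarrow>
      trilinear_form S (e i) (e j) (e k) = trilinear_form T (e i) (e j) (e k)"
  shows "S = T"
proof -
  have sp: "x \<in> vec.span (e ` I)" for x using e by (simp add: is_basis_def)
  note lin = vec.subspace_def trilinear_form_add trilinear_form_scale
  have 1: "trilinear_form S (e i) (e j) z = trilinear_form T (e i) (e j) z"
    if "i \<in> I" "j \<in> I" for i j z
    using sp[of z] by (induction rule: vec.span_induct) (use that in \<open>auto simp: lin eq\<close>)
  have 2: "trilinear_form S (e i) y z = trilinear_form T (e i) y z" if "i \<in> I" for i y z
    using sp[of y] by (induction rule: vec.span_induct) (use that in \<open>auto simp: lin 1\<close>)
  have "trilinear_form S x y z = trilinear_form T x y z" for x y z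
    using sp[of x] by (induction rule: vec.span_induct) (auto simp: lin 2)
  then show ?thesis
    by (metis trilinear_form_axis vec_eq_iff)
qed

lemma scalar_product_eq_0_on_basis:
  assumes e: "is_basis I e" and "\<And>i. i \<in> I \<Longrightarrow> scalar_product (e i) y = 0"
  shows "y = 0"
proof (rule scalar_product_eq_0)
  fix x
  have "x \<in> vec.span (e ` I)" using e by (simp add: is_basis_def)
  then show "scalar_product x y = 0"
    by (induction rule: vec.span_induct)
      (use assms in \<open>auto simp: vec.subspace_def scalar_product_simps\<close>)
qed

section \<open>Genericity as a nonvanishing determinant\<close>

lemma rank_full_iff_det:
  fixes M :: "complex^'n::finite^'n"
  shows "rank M = CARD('n) \<longleftrightarrow> det M \<noteq> 0"
proof -
  have "rank M = CARD('n) \<longleftrightarrow> vec.span (rows M) = UNIV"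
    unfolding row_rank_def_gen by (metis vec.dim_eq_full vec_dim_card vec.span_UNIV)
  also have "\<dots> \<longleftrightarrow> invertible M"
    by (simp add: invertible_left_inverse matrix_left_invertible_span_rows_gen)
  finally show ?thesis by (simp add: invertible_det_nz)
qed

lemma det_nonzero_iff_kernel:
  fixes M :: "complex^'n::finite^'n"
  shows "det M \<noteq> 0 \<longleftrightarrow> (\<forall>x. M *v x = 0 \<longrightarrow> x = 0)"
  by (metis invertible_det_nz invertible_left_inverse matrix_left_invertible_ker)

lemma flat_B_eq_flat_A: "symmetric_tensor T \<Longrightarrow> flat_B T = flat_A T"
  unfolding fun_eq_iff flat_A_def flat_B_def symmetric_tensor_def vec_eq_iff
  by (auto intro!: sum.cong)

lemma flat_C_eq_flat_A:
  assumes "symmetric_tensor T" shows "flat_C T = flat_A T"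
proof -
  have "T $ i $ j $ k = T $ k $ i $ j" for i j k
    using assms unfolding symmetric_tensor_def by metis
  then show ?thesis
    unfolding fun_eq_iff flat_A_def flat_C_def vec_eq_iff by simp
qed

text \<open>By symmetry the three flattenings coincide, so a single space of matrices has to contain
  an invertible one.\<close>

lemma one_generic_symmetric:
  assumes "symmetric_tensor T"
  shows "one_generic T \<longleftrightarrow> (\<exists>x. det (flat_A T x) \<noteq> 0)"
  unfolding one_generic_def one_A_generic_def one_B_generic_def one_C_generic_def
    flat_B_eq_flat_A[OF assms] flat_C_eq_flat_A[OF assms]
  by (auto simp: rank_full_iff_det)

section \<open>The two normal forms\<close>

text \<open>A basis of \<open>H\<close> together with a vector \<open>v\<close> outside
  \<open>H\<close> is a basis of the whole space; \<open>l\<close> is the member of the dual basis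
  that belongs to \<open>v\<close>.\<close>

lemma hyperplane_functional:
  assumes "hyperplane (H :: (complex^'n::finite) set)"
  obtains l v where "scalar_product l v = 1" "\<And>x. x \<in> H \<longleftrightarrow> scalar_product l x = 0"
proof -
  have H: "vec.subspace H" "vec.dim H + 1 = CARD('n)" using assms by (auto simp: hyperplane_def)
  obtain B where B: "B \<subseteq> H" "vec.independent B" "H \<subseteq> vec.span B" "card B = vec.dim H"
    using vec.basis_exists by blast
  have spB: "vec.span B = H" using B(1,3) H(1) by (simp add: subset_antisym vec.span_minimal)
  have finB: "finite B" using B(2) vec.finiteI_independent by blast
  obtain v where v: "v \<notin> H"
    using H(2) vec_dim_card[where 'n='n and 'a=complex] by (metis UNIV_eq_I add_cancel_right_right zero_neq_one)
  have vB: "v \<notin> B" using v B(1) by auto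
  have ind: "vec.independent (insert v B)"
    using B(2) v spB by (simp add: vec.independent_insert)
  have card: "card (insert v B) = CARD('n)" using vB finB B(4) H(2) by simp
  obtain h where h: "bij_betw h {0..<CARD('n)} (insert v B)"
    using ex_bij_betw_nat_finite[of "insert v B"] finB card by auto
  have "UNIV \<subseteq> vec.span (insert v B)"
    by (rule vec.card_ge_dim_independent) (use ind card in \<open>simp_all add: card_cart_basis\<close>)
  then have sp: "vec.span (insert v B) = UNIV" by auto
  then have hb: "is_basis {0..<CARD('n)} h"
    using h ind by (auto simp: is_basis_def bij_betw_def)
  obtain a where "dual_families {0..<CARD('n)} h a"
    by (rule is_basis_dual[OF hb]) simp_all
  then have a: "dual_families {0..<CARD('n)} a h" by (rule dual_families_sym)
  have himg: "\<exists>i\<in>{0..<CARD('n)}. h i = b" if "b \<in> insert v B" for b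
  proof -
    have "b \<in> h ` {0..<CARD('n)}" using that by (simp only: bij_betw_imp_surj_on[OF h])
    then show ?thesis by (metis imageE)
  qed
  obtain i where i: "i \<in> {0..<CARD('n)}" "h i = v" using himg by blast
  define l where "l = a i"
  have lv: "scalar_product l v = 1"
    using a i unfolding dual_families_def l_def by metis
  have lb: "scalar_product l b = 0" if bB: "b \<in> B" for b
  proof -
    obtain j where j: "j \<in> {0..<CARD('n)}" "h j = b"
      using himg[OF insertI2[OF bB]] by blast
    then have "i \<noteq> j" using i vB bB by auto
    then show ?thesis
      using a i j unfolding dual_families_def l_def by metis
  qed
  have lH: "scalar_product l x = 0" if "x \<in> H" for x
  proof -
    have "x \<in> vec.span B" using that spB by simp
    then show ?thesis
      by (induction rule: vec.span_induct) (auto simp: vec.subspace_def scalar_product_simps lb)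
  qed
  have "x \<in> H" if x: "scalar_product l x = 0" for x
  proof -
    have "x \<in> vec.span (insert v B)" using sp by simp
    then obtain k where k: "x - k *s v \<in> H" using spB by (auto simp: vec.span_breakdown_eq)
    then have "k = 0" using lH[OF k] x lv by (simp add: scalar_product_simps)
    then show ?thesis using k by simp
  qed
  with lv lH that show thesis by blast
qed

text \<open>Over the complex numbers every vector with \<open>Q w w\<close> nonzero can be scaled to
  \<open>Q w w = 1\<close> and appended, so a family of maximal length leaves only isotropic vectors
  in its orthogonal complement. The form may be degenerate on \<open>H\<close>, hence the complement
  need not be zero.\<close>

lemma orthonormal_family_maximal:
  fixes M :: "complex^'n::finite^'n" and H
  defines "Q \<equiv> \<lambda>x y. scalar_product x (M *v y)"
  assumes sym: "\<And>x y. Q x y = Q y x" and H: "vec.subspace H"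
  obtains r :: nat and e where "\<And>i. i \<in> {1..r} \<Longrightarrow> e i \<in> H"
    "\<And>i j. i \<in> {1..r} \<Longrightarrow> j \<in> {1..r} \<Longrightarrow> Q (e i) (e j) = (if i = j then 1 else 0)"
    "\<And>w. w \<in> H \<Longrightarrow> (\<And>i. i \<in> {1..r} \<Longrightarrow> Q (e i) w = 0) \<Longrightarrow> Q w w = 0"
proof -
  define P where "P r e \<longleftrightarrow> (\<forall>i\<in>{1..r}. e i \<in> H) \<and>
      (\<forall>i\<in>{1..r}. \<forall>j\<in>{1..r}. Q (e i) (e j) = (if i = j then 1 else 0))" for r :: nat and e
  have bound: "r \<le> CARD('n)" if "P r e" for r e
  proof -
    \<comment> \<open>The vectors \<open>M *v e i\<close> are dual to the \<open>e i\<close>; this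
      makes the \<open>e i\<close> independent and bounds the length, so that a greatest
      \<open>r\<close> exists.\<close>
    have d: "dual_families {1..r} e (\<lambda>i. M *v e i)"
      using that by (auto simp: dual_families_def P_def Q_def)
    have "card (e ` {1..r}) \<le> vec.dim (UNIV :: (complex^'n) set)"
      by (rule vec.independent_card_le_dim)
        (use dual_families_independent(2)[OF _ dual_families_sym[OF d]] in auto)
    then show ?thesis
      using dual_families_independent(1)[OF _ dual_families_sym[OF d]]
      by (simp add: card_image card_cart_basis)
  qed
  define r where "r = (GREATEST r. \<exists>e. P r e)"
  have "\<exists>e. P 0 e" by (simp add: P_def)
  then have "\<exists>e. P r e"
    unfolding r_def by (rule GreatestI_nat[where b = "CARD('n)"]) (use bound in blast)
  then obtain e where e: "P r e" by blast
  have "Q w w = 0" if w: "w \<in> H" and orth: "\<And>i. i \<in> {1..r} \<Longrightarrow> Q (e i) w = 0" for w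
  proof (rule ccontr)
    assume nz: "Q w w \<noteq> 0"
    define s where "s = csqrt (Q w w)"
    have s: "s * s = Q w w" "s \<noteq> 0" using nz by (simp_all add: s_def flip: power2_eq_square)
    define w' where "w' = (1 / s) *s w"
    have Qs: "Q x (k *s y) = k * Q x y" "Q (k *s x) y = k * Q x y" for k x y
      by (simp_all add: Q_def vector_scalar_commute scalar_product_simps)
    have w': "Q w' w' = 1" using s nz by (simp add: w'_def Qs field_simps)
    have o: "Q (e i) w' = 0" "Q w' (e i) = 0" if "i \<in> {1..r}" for i
      using orth[OF that] by (simp_all add: w'_def Qs sym[of w])
    have "P (Suc r) (e(Suc r := w'))"
      unfolding P_def
    proof (intro conjI ballI)
      fix i assume "i \<in> {1..Suc r}"
      then show "(e(Suc r := w')) i \<in> H"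
        using e w H by (auto simp: P_def w'_def vec.subspace_scale)
    next
      fix i j assume "i \<in> {1..Suc r}" "j \<in> {1..Suc r}"
      then show "Q ((e(Suc r := w')) i) ((e(Suc r := w')) j) = (if i = j then 1 else 0)"
        using e o w' by (auto simp: P_def le_Suc_eq)
    qed
    then have "Suc r \<le> r"
      unfolding r_def by (intro Greatest_le_nat[where b = "CARD('n)"]) (use bound in blast)+
    then show False by simp
  qed
  with e that[of r e] show thesis by (auto simp: P_def)
qed

section \<open>Coppersmith-Winograd tensors evaluated on a dual basis\<close>

lemma sum_delta_delta:
  "(\<Sum>s\<in>{1..q}. (if s = i then 1 else 0) * (if s = j then 1 else 0)) =
     (if i = j \<and> i \<in> {1..q} then 1 else 0 :: complex)"
  for i j q :: nat
proof -
  have "(\<Sum>s\<in>{1..q}. (if s = i then 1 else 0) * (if s = j then 1 else 0)) =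
      (\<Sum>s\<in>{1..q}. if s = i then (if i = j then 1 else 0) else 0 :: complex)"
    by (rule sum.cong) auto
  then show ?thesis by (simp add: sum.delta)
qed

lemma trilinear_form_cw_tensor:
  "trilinear_form (cw_tensor q a b c) x y z =
     scalar_product (a 0) x * (\<Sum>s=1..q. scalar_product (b s) y * scalar_product (c s) z)
   + scalar_product (b 0) y * (\<Sum>s=1..q. scalar_product (a s) x * scalar_product (c s) z)
   + scalar_product (c 0) z * (\<Sum>s=1..q. scalar_product (a s) x * scalar_product (b s) y)"
  by (simp add: cw_tensor_def trilinear_form_tensor_sum trilinear_form_tensor_add
      trilinear_form_tensor_prod sum.distrib sum_distrib_left mult_ac)

text \<open>The bound \<open>q \<le> n\<close> leaves room for basis vectors beyond
  \<open>q\<close>: the tensor \<open>cw_tilde_tensor\<close> is treated with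
  \<open>n = q + 1\<close>.\<close>

lemma trilinear_form_cw_tensor_dual:
  assumes d: "dual_families {0..n} a f" and q: "q \<le> n" and ijk: "i \<le> n" "j \<le> n" "k \<le> n"
  shows "trilinear_form (cw_tensor q a a a) (f i) (f j) (f k) =
      (if i = 0 \<and> j = k \<and> j \<in> {1..q} then 1 else 0)
    + (if j = 0 \<and> i = k \<and> i \<in> {1..q} then 1 else 0)
    + (if k = 0 \<and> i = j \<and> i \<in> {1..q} then 1 else 0)"
proof -
  have sp: "scalar_product (a s) (f t) = (if s = t then 1 else 0)" if "s \<le> n" "t \<le> n" for s t
    using d that by (auto simp: dual_families_def)
  have S: "(\<Sum>s=1..q. scalar_product (a s) (f t) * scalar_product (a s) (f u)) =
      (if t = u \<and> t \<in> {1..q} then 1 else 0)" if "t \<le> n" "u \<le> n" for t u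
    unfolding sum_delta_delta[symmetric]
    by (rule sum.cong) (use that q in \<open>auto simp: sp\<close>)
  show ?thesis
    unfolding trilinear_form_cw_tensor S[OF ijk(1,2)] S[OF ijk(1,3)] S[OF ijk(2,3)]
    using ijk by (auto simp: sp)
qed

lemma trilinear_form_cw_tilde_tensor_dual:
  assumes d: "dual_families {0..q+1} a f" and ijk: "i \<le> q+1" "j \<le> q+1" "k \<le> q+1"
  shows "trilinear_form (cw_tilde_tensor q a a a) (f i) (f j) (f k) =
      (if i = 0 \<and> j = k \<and> j \<in> {1..q} then 1 else 0)
    + (if j = 0 \<and> i = k \<and> i \<in> {1..q} then 1 else 0)
    + (if k = 0 \<and> i = j \<and> i \<in> {1..q} then 1 else 0)
    + (if i = 0 \<and> j = 0 \<and> k = q+1 then 1 else 0)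
    + (if i = 0 \<and> j = q+1 \<and> k = 0 then 1 else 0)
    + (if i = q+1 \<and> j = 0 \<and> k = 0 then 1 else 0)"
proof -
  have sp: "scalar_product (a s) (f t) = (if s = t then 1 else 0)" if "s \<le> q+1" "t \<le> q+1" for s t
    using d that by (auto simp: dual_families_def)
  have "cw_tilde_tensor q a a a = cw_tensor q a a a + tensor_prod (a 0) (a 0) (a (q+1))
      + tensor_prod (a 0) (a (q+1)) (a 0) + tensor_prod (a (q+1)) (a 0) (a 0)"
    by (simp add: cw_tilde_tensor_def cw_tensor_def)
  then show ?thesis
    using trilinear_form_cw_tensor_dual[OF d _ ijk, of q] ijk
    by (auto simp: trilinear_form_tensor_add trilinear_form_tensor_prod sp)
qed

text \<open>Beyond orthonormality two things are arranged: the transversal vector is corrected to a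
  \<open>u\<close> for which no mixed term with the \<open>e i\<close> survives, and maximality of
  the family is upgraded from isotropy of the complement to membership in the radical.\<close>

lemma compressible_normal_family:
  assumes sym: "symmetric_tensor (T :: 'n::finite tensor3)" and comp: "max_sym_compressible T"
  obtains l u and e :: "nat \<Rightarrow> complex^'n" and r :: nat where
    "scalar_product l u = 1"
    "\<And>x y z. scalar_product l x = 0 \<Longrightarrow> scalar_product l y = 0 \<Longrightarrow> scalar_product l z = 0 \<Longrightarrow>
       trilinear_form T x y z = 0"
    "\<And>i. i \<in> {1..r} \<Longrightarrow> scalar_product l (e i) = 0"
    "\<And>i j. i \<in> {1..r} \<Longrightarrow> j \<in> {1..r} \<Longrightarrow>
       trilinear_form T u (e i) (e j) = (if i = j then 1 else 0)"
    "\<And>i. i \<in> {1..r} \<Longrightarrow> trilinear_form T u u (e i) = 0"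
    "\<And>w y. scalar_product l w = 0 \<Longrightarrow> (\<And>i. i \<in> {1..r} \<Longrightarrow> trilinear_form T u (e i) w = 0) \<Longrightarrow>
       scalar_product l y = 0 \<Longrightarrow> trilinear_form T u w y = 0"
proof -
  obtain H where H: "hyperplane H"
    and van: "\<And>x y z. x \<in> H \<Longrightarrow> y \<in> H \<Longrightarrow> z \<in> H \<Longrightarrow> trilinear_form T x y z = 0"
    using comp unfolding max_sym_compressible_def by blast
  obtain l v where lv: "scalar_product l v = 1" and lH: "\<And>x. x \<in> H \<longleftrightarrow> scalar_product l x = 0"
    using hyperplane_functional[OF H] by blast
  note s12 = trilinear_form_swap12[OF sym] and s23 = trilinear_form_swap23[OF sym]
  note lin = trilinear_form_add trilinear_form_diff trilinear_form_scale
  have sub: "vec.subspace H" using H by (simp add: hyperplane_def)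
  obtain r :: nat and e where eH: "\<And>i. i \<in> {1..r} \<Longrightarrow> e i \<in> H"
    and ee: "\<And>i j. i \<in> {1..r} \<Longrightarrow> j \<in> {1..r} \<Longrightarrow>
      trilinear_form T v (e i) (e j) = (if i = j then 1 else 0)"
    and emax: "\<And>w. w \<in> H \<Longrightarrow> (\<And>i. i \<in> {1..r} \<Longrightarrow> trilinear_form T v (e i) w = 0) \<Longrightarrow>
      trilinear_form T v w w = 0"
    by (rule orthonormal_family_maximal[where M = "flat_A T v",
          folded trilinear_form_flat_A, OF s23[of v] sub]) blast
  define h where "h = (\<Sum>i\<in>{1..r}. trilinear_form T v v (e i) *s e i)"
  \<comment> \<open>The correction enters \<open>trilinear_form T u u (e i)\<close> linearly through
    two slots, whence the factor 1/2; the term quadratic in \<open>h\<close> vanishes because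
    \<open>h\<close> and \<open>e i\<close> lie in \<open>H\<close>.\<close>
  define u where "u = v - (1/2) *s h"
  have hH: "h \<in> H"
    unfolding h_def using sub eH by (intro vec.subspace_sum vec.subspace_scale) auto
  have u_H: "trilinear_form T u x y = trilinear_form T v x y" if "x \<in> H" "y \<in> H" for x y
    using van[OF hH that] by (simp add: u_def lin)
  \<comment> \<open>Maximality controls only the values \<open>trilinear_form T v w w\<close>;
    polarisation recovers the bilinear form on the orthogonal complement.\<close>
  have polar: "trilinear_form T v w w' = 0"
    if w: "w \<in> H" "\<And>i. i \<in> {1..r} \<Longrightarrow> trilinear_form T v (e i) w = 0"
      and w': "w' \<in> H" "\<And>i. i \<in> {1..r} \<Longrightarrow> trilinear_form T v (e i) w' = 0" for w w'
  proof -
    have "trilinear_form T v (w + w') (w + w') = 0"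
      by (rule emax) (use w w' sub in \<open>auto simp: lin vec.subspace_add\<close>)
    then have "2 * trilinear_form T v w w' = 0"
      using emax[OF w] emax[OF w'] s23[of v w' w] by (simp add: lin)
    then show ?thesis by simp
  qed
  have proj: "trilinear_form T v (e i) (\<Sum>j\<in>{1..r}. c j *s e j) = c i" if "i \<in> {1..r}" for i c
  proof -
    have "trilinear_form T v (e i) (\<Sum>j\<in>{1..r}. c j *s e j) = (\<Sum>j\<in>{1..r}. if i = j then c j else 0)"
      unfolding trilinear_form_sum trilinear_form_scale
      by (rule sum.cong) (use that in \<open>auto simp: ee\<close>)
    then show ?thesis using that by simp
  qed
  have rad: "trilinear_form T v w y = 0"
    if w: "w \<in> H" "\<And>i. i \<in> {1..r} \<Longrightarrow> trilinear_form T v (e i) w = 0" and y: "y \<in> H" for w y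
  proof -
    \<comment> \<open>\<open>y'\<close> is the component of \<open>y\<close> in the span of the
      family, so \<open>y - y'\<close> lies in the orthogonal complement, and \<open>w\<close>
      annihilates both pieces.\<close>
    define y' where "y' = (\<Sum>i\<in>{1..r}. trilinear_form T v (e i) y *s e i)"
    have y': "y' \<in> H"
      unfolding y'_def using sub eH by (intro vec.subspace_sum vec.subspace_scale) auto
    have "trilinear_form T v w (y - y') = 0"
    proof (rule polar[OF w])
      show "y - y' \<in> H" using y y' sub by (simp add: vec.subspace_diff)
      show "trilinear_form T v (e i) (y - y') = 0" if i: "i \<in> {1..r}" for i
        unfolding lin y'_def proj[OF i] by simp
    qed
    moreover have "trilinear_form T v w y' = 0"
      unfolding y'_def trilinear_form_sum trilinear_form_scale
      by (rule sum.neutral) (use w s23[of v w] in auto)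
    ultimately show ?thesis by (simp add: lin)
  qed
  show thesis
  proof (rule that[of l u r e])
    show "scalar_product l u = 1"
      using lv hH lH by (simp add: u_def scalar_product_simps)
    show "trilinear_form T u u (e i) = 0" if i: "i \<in> {1..r}" for i
    proof -
      have "trilinear_form T v h (e i) = trilinear_form T v v (e i)"
        using proj[OF i] s23[of v h] by (simp add: h_def)
      moreover have "trilinear_form T h v (e i) = trilinear_form T v h (e i)"
        by (rule s12)
      moreover have "trilinear_form T h h (e i) = 0"
        using hH eH[OF i] by (intro van)
      ultimately show ?thesis by (simp add: u_def lin)
    qed
    show "trilinear_form T u w y = 0"
      if "scalar_product l w = 0" "\<And>i. i \<in> {1..r} \<Longrightarrow> trilinear_form T u (e i) w = 0"
        "scalar_product l y = 0" for w y
      using that rad[of w y] by (simp add: lH[symmetric] u_H eH)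
  qed (use van eH lH ee u_H in auto)
qed

text \<open>The split is by the radical \<open>R\<close> of \<open>trilinear_form T u0\<close> on
  the kernel of \<open>l\<close>. In both cases vectors \<open>f\<close> adapted to
  \<open>l\<close>, the orthonormal family and \<open>R\<close> are collected, and \<open>a\<close>
  consists of the functionals dual to them. In the first case no radical vector is available to
  absorb the cubic coefficient \<open>c\<close>.\<close>

lemma generic_compressible_cases:
  fixes T :: "'n::finite tensor3"
  assumes sym: "symmetric_tensor T" and gen: "one_generic T" and comp: "max_sym_compressible T"
  obtains
    (nondegenerate) c a r where "r + 1 = CARD('n)" "is_basis {0..r} a"
      "T = tensor_prod (c *s a 0) (a 0) (a 0) + cw_tensor r a a a"
  | (degenerate) a r where "r + 2 = CARD('n)" "is_basis {0..r+1} a" "T = cw_tilde_tensor r a a a"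
proof -
  obtain l u0 and e :: "nat \<Rightarrow> complex^'n" and r :: nat where
    lu0: "scalar_product l u0 = 1" and
    van: "\<And>x y z. scalar_product l x = 0 \<Longrightarrow> scalar_product l y = 0 \<Longrightarrow> scalar_product l z = 0 \<Longrightarrow>
       trilinear_form T x y z = 0" and
    le: "\<And>i. i \<in> {1..r} \<Longrightarrow> scalar_product l (e i) = 0" and
    ee0: "\<And>i j. i \<in> {1..r} \<Longrightarrow> j \<in> {1..r} \<Longrightarrow>
       trilinear_form T u0 (e i) (e j) = (if i = j then 1 else 0)" and
    uue0: "\<And>i. i \<in> {1..r} \<Longrightarrow> trilinear_form T u0 u0 (e i) = 0" and
    rad0: "\<And>w y. scalar_product l w = 0 \<Longrightarrow> (\<And>i. i \<in> {1..r} \<Longrightarrow> trilinear_form T u0 (e i) w = 0) \<Longrightarrow>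
       scalar_product l y = 0 \<Longrightarrow> trilinear_form T u0 w y = 0"
    by (rule compressible_normal_family[OF sym comp]) blast
  note s12 = trilinear_form_swap12[OF sym] and s23 = trilinear_form_swap23[OF sym]
  note lin = trilinear_form_add trilinear_form_diff trilinear_form_scale
  define R where "R = {w. scalar_product l w = 0 \<and> (\<forall>y. scalar_product l y = 0 \<longrightarrow> trilinear_form T u0 w y = 0)}"
  obtain \<alpha> where \<alpha>: "det (flat_A T \<alpha>) \<noteq> 0" using gen one_generic_symmetric[OF sym] by blast
  have inj: "w = 0" if w: "w \<in> R" "trilinear_form T u0 u0 w = 0" for w
  proof -
    have lw: "scalar_product l w = 0" and wy: "\<And>y. scalar_product l y = 0 \<Longrightarrow> trilinear_form T u0 w y = 0"
      using w by (auto simp: R_def)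
    have "trilinear_form T x w y = 0" for x y
    proof -
      define x' y' where "x' = x - scalar_product l x *s u0" and "y' = y - scalar_product l y *s u0"
      have l': "scalar_product l x' = 0" "scalar_product l y' = 0"
        by (simp_all add: x'_def y'_def scalar_product_simps lu0)
      have xy: "x = x' + scalar_product l x *s u0" "y = y' + scalar_product l y *s u0"
        by (simp_all add: x'_def y'_def)
      have "trilinear_form T x' w y' = 0" using l' lw van by blast
      moreover have "trilinear_form T u0 w y' = 0" using wy l' by blast
      moreover have "trilinear_form T x' w u0 = 0"
        using wy[OF l'(1)] by (metis s12 s23)
      moreover have "trilinear_form T u0 w u0 = 0"
        using w(2) by (metis s23)
      ultimately show ?thesis
        by (subst xy(1), subst xy(2)) (simp add: lin)
    qed
    then have "scalar_product x (flat_A T \<alpha> *v w) = 0" for x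
      by (metis trilinear_form_flat_A s23)
    then have "flat_A T \<alpha> *v w = 0" by (rule scalar_product_eq_0)
    then show "w = 0" using \<alpha> det_nonzero_iff_kernel by blast
  qed
  have dec: "x - (\<Sum>i\<in>{1..r}. trilinear_form T u0 (e i) x *s e i) \<in> R"
    if x: "scalar_product l x = 0" for x
  proof -
    define p where "p = (\<Sum>i\<in>{1..r}. trilinear_form T u0 (e i) x *s e i)"
    have pr: "trilinear_form T u0 (e i) p = trilinear_form T u0 (e i) x" if i: "i \<in> {1..r}" for i
    proof -
      have "trilinear_form T u0 (e i) p = (\<Sum>j\<in>{1..r}. if i = j then trilinear_form T u0 (e j) x else 0)"
        unfolding p_def trilinear_form_sum trilinear_form_scale
        by (rule sum.cong) (use i in \<open>auto simp: ee0\<close>)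
      then show ?thesis using i by simp
    qed
    have lp: "scalar_product l p = 0"
      unfolding p_def scalar_product_simps by (rule sum.neutral) (use le in auto)
    have lxp: "scalar_product l (x - p) = 0" using x lp by (simp add: scalar_product_simps)
    have "trilinear_form T u0 (x - p) y = 0" if y: "scalar_product l y = 0" for y
      by (rule rad0[OF lxp _ y]) (simp only: lin pr diff_self)
    with lxp show ?thesis unfolding R_def p_def by blast
  qed
  \<comment> \<open>By \<open>inj\<close>, the functional \<open>trilinear_form T u0 u0\<close>
    vanishes on \<open>R\<close> only if \<open>R\<close> is zero; otherwise \<open>R\<close> is a
    line on which it is nonzero.\<close>
  show thesis
  proof (cases "\<forall>w\<in>R. trilinear_form T u0 u0 w = 0")
    case True
    define f where "f = e(0 := u0)"
    \<comment> \<open>The functional dual to \<open>e i\<close> is the pairing with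
      \<open>e i\<close> under \<open>trilinear_form T u0\<close>: it is 1 at \<open>e i\<close> and
      0 at the other \<open>e j\<close> and at \<open>u0\<close>.\<close>
    define a where "a = (\<lambda>i. if i = 0 then l else flat_A T u0 *v e i)"
    define c where "c = trilinear_form T u0 u0 u0"
    have f: "f 0 = u0" "\<And>i. i \<in> {1..r} \<Longrightarrow> f i = e i" by (auto simp: f_def)
    have dual: "dual_families {0..r} a f"
      unfolding dual_families_def
      using lu0 le ee0 uue0
      by (auto simp: a_def f_def scalar_product_commute[of "_ *v _"] simp flip: trilinear_form_flat_A)
    have span: "x \<in> vec.span (f ` {0..r})" for x
    proof -
      define x' where "x' = x - scalar_product l x *s u0"
      have "scalar_product l x' = 0" by (simp add: x'_def scalar_product_simps lu0)
      then have "x' = (\<Sum>i\<in>{1..r}. trilinear_form T u0 (e i) x' *s e i)"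
        using dec inj True by (metis eq_iff_diff_eq_0)
      also have "\<dots> \<in> vec.span (f ` {0..r})"
        by (intro vec.span_sum vec.span_scale vec.span_base) (use f(2) in force)
      finally have "x' + scalar_product l x *s u0 \<in> vec.span (f ` {0..r})"
        by (intro vec.span_add vec.span_scale) (auto intro: vec.span_base simp flip: f(1))
      then show ?thesis by (simp add: x'_def)
    qed
    have fb: "is_basis {0..r} f"
      unfolding is_basis_def using dual_families_independent[OF _ dual] span by auto
    have card: "card {0..r} = CARD('n)" by (rule is_basis_card[OF fb])
    have ab: "is_basis {0..r} a"
      by (rule dual_families_is_basis[OF _ dual_families_sym[OF dual] card]) simp
    have a0: "a 0 = l" by (simp add: a_def)
    have "trilinear_form T (f i) (f j) (f k) =
        trilinear_form (tensor_prod (c *s a 0) (a 0) (a 0) + cw_tensor r a a a) (f i) (f j) (f k)"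
      if ijk: "i \<in> {0..r}" "j \<in> {0..r}" "k \<in> {0..r}" for i j k
    proof -
      have t1: "trilinear_form T (e i) u0 (e j) = trilinear_form T u0 (e i) (e j)"
        "trilinear_form T (e i) (e j) u0 = trilinear_form T u0 (e i) (e j)"
        "trilinear_form T u0 (e i) u0 = trilinear_form T u0 u0 (e i)"
        "trilinear_form T (e i) u0 u0 = trilinear_form T u0 u0 (e i)" for i j
        by (metis s12 s23)+
      show ?thesis
        unfolding trilinear_form_tensor_add trilinear_form_tensor_prod
        using ijk trilinear_form_cw_tensor_dual[OF dual order_refl, of i j k]
        by (cases "i = 0"; cases "j = 0"; cases "k = 0")
          (auto simp: a0 lu0 f c_def t1 ee0 uue0 le van scalar_product_scale_left)
    qed
    then have "T = tensor_prod (c *s a 0) (a 0) (a 0) + cw_tensor r a a a"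
      by (rule tensor_eq_on_basis[OF fb])
    with ab card nondegenerate[of r a c] show thesis by simp
  next
    case False
    then obtain w0 where w0: "w0 \<in> R" "trilinear_form T u0 u0 w0 \<noteq> 0" by blast
    define w where "w = (1 / trilinear_form T u0 u0 w0) *s w0"
    have w: "w \<in> R" "trilinear_form T u0 u0 w = 1"
      using w0 by (auto simp: w_def R_def lin scalar_product_simps)
    then have lw: "scalar_product l w = 0"
      and wy0: "\<And>y. scalar_product l y = 0 \<Longrightarrow> trilinear_form T u0 w y = 0"
      by (auto simp: R_def)
    \<comment> \<open>In the cube at \<open>u\<close> the term linear in \<open>w\<close> occurs
      three times with \<open>trilinear_form T u0 u0 w = 1\<close>, and terms with two or three
      factors \<open>w\<close> vanish. A third of the cubic coefficient therefore makes
      \<open>trilinear_form T u u u\<close> zero.\<close>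
    define u where "u = u0 - (trilinear_form T u0 u0 u0 / 3) *s w"
    have u_H: "trilinear_form T u x y = trilinear_form T u0 x y"
      if "scalar_product l x = 0" "scalar_product l y = 0" for x y
      using van[OF lw that] by (simp add: u_def lin)
    have lu: "scalar_product l u = 1" by (simp add: u_def scalar_product_simps lu0 lw)
    have ee: "trilinear_form T u (e i) (e j) = (if i = j then 1 else 0)" if "i \<in> {1..r}" "j \<in> {1..r}" for i j
      using that ee0 le by (simp add: u_H)
    have wy: "trilinear_form T u w y = 0" if "scalar_product l y = 0" for y
      using that wy0 lw by (simp add: u_H)
    have t0: "trilinear_form T w u0 u0 = 1" "trilinear_form T u0 w u0 = 1"
      "trilinear_form T w u0 w = 0" "trilinear_form T w w u0 = 0" "trilinear_form T u0 w w = 0"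
      "trilinear_form T w w w = 0"
      using w(2) wy0[OF lw] van[OF lw lw lw] by (metis s12 s23)+
    have uue: "trilinear_form T u u (e i) = 0" if "i \<in> {1..r}" for i
    proof -
      have "trilinear_form T w u0 (e i) = 0" "trilinear_form T u0 w (e i) = 0" "trilinear_form T w w (e i) = 0"
        using wy0[OF le[OF that]] van[OF lw lw le[OF that]] by (metis s12)+
      then show ?thesis using uue0[OF that] by (simp add: u_def lin)
    qed
    have uuw: "trilinear_form T u u w = 1"
      by (simp add: u_def lin t0 w(2))
    have uuu: "trilinear_form T u u u = 0"
      by (simp add: u_def lin t0 w(2))
    define f where "f = e(0 := u, r + 1 := w)"
    \<comment> \<open>As \<open>w\<close> is orthogonal to the whole kernel of \<open>l\<close>, its
      dual functional has to come from pairing with \<open>u\<close>: this gives 1 at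
      \<open>w\<close>, and 0 at the \<open>e i\<close> and, by the choice of \<open>u\<close>, at
      \<open>u\<close> itself.\<close>
    define a where "a = (\<lambda>i. if i = 0 then l else if i = r + 1 then flat_A T u *v u else flat_A T u *v e i)"
    have f: "f 0 = u" "f (r + 1) = w" "f (Suc r) = w" "\<And>i. i \<in> {1..r} \<Longrightarrow> f i = e i" by (auto simp: f_def)
    have uwe: "trilinear_form T u w (e i) = 0" "trilinear_form T u (e i) w = 0" if "i \<in> {1..r}" for i
      using wy[OF le[OF that]] s23[of u w "e i"] by auto
    have ueu: "trilinear_form T u (e i) u = 0" if "i \<in> {1..r}" for i
      using uue[OF that] by (metis s23)
    have uwu: "trilinear_form T u w u = 1" using uuw by (metis s23)
    have dual: "dual_families {0..r+1} a f"
      unfolding dual_families_def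
    proof (intro ballI)
      fix i j assume ij: "i \<in> {0..r+1}" "j \<in> {0..r+1}"
      then have i: "i = 0 \<or> i = r+1 \<or> i \<in> {1..r}" and j: "j = 0 \<or> j = r+1 \<or> j \<in> {1..r}" by auto
      have sp: "scalar_product (a i) (f j) = (if i = 0 then scalar_product l (f j)
          else if i = r + 1 then trilinear_form T u (f j) u else trilinear_form T u (f j) (e i))"
        by (auto simp: a_def trilinear_form_flat_A scalar_product_commute)
      show "scalar_product (a i) (f j) = (if i = j then 1 else 0)"
        unfolding sp using i j
        by (elim disjE) (simp_all add: f lu le lw ee uue uuw ueu uwu uuu uwe)
    qed
    have span: "x \<in> vec.span (f ` {0..r+1})" for x
    proof -
      define x' where "x' = x - scalar_product l x *s u"
      have lx': "scalar_product l x' = 0" by (simp add: x'_def scalar_product_simps lu)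
      define x2 where "x2 = x' - (\<Sum>i\<in>{1..r}. trilinear_form T u0 (e i) x' *s e i)"
      have x2: "x2 \<in> R" unfolding x2_def by (rule dec[OF lx'])
      \<comment> \<open>Subtracting \<open>d *s w\<close> moves the radical part into the zero set
        of the functional, where \<open>inj\<close> leaves only zero; hence \<open>w\<close> spans
        \<open>R\<close>.\<close>
      define d where "d = trilinear_form T u0 u0 x2"
      have "x2 - d *s w \<in> R" "trilinear_form T u0 u0 (x2 - d *s w) = 0"
        using x2 w by (auto simp: R_def lin scalar_product_simps d_def)
      then have "x2 - d *s w = 0" by (rule inj)
      then have "x = (\<Sum>i\<in>{1..r}. trilinear_form T u0 (e i) x' *s e i) + d *s w + scalar_product l x *s u"
        by (simp add: x2_def x'_def algebra_simps)
      also have "\<dots> \<in> vec.span (f ` {0..r+1})"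
      proof -
        have "e i \<in> vec.span (f ` {0..r+1})" if "i \<in> {1..r}" for i
          by (rule vec.span_base) (rule image_eqI[of _ _ i], use f(4)[OF that] that in auto)
        moreover have "u \<in> vec.span (f ` {0..r+1})"
          by (rule vec.span_base) (rule image_eqI[of _ _ 0], use f(1) in auto)
        moreover have "w \<in> vec.span (f ` {0..r+1})"
          by (rule vec.span_base) (rule image_eqI[of _ _ "r + 1"], use f(2) in auto)
        ultimately show ?thesis by (intro vec.span_add vec.span_sum vec.span_scale)
      qed
      finally show ?thesis .
    qed
    have fb: "is_basis {0..r+1} f"
      unfolding is_basis_def using dual_families_independent[OF _ dual] span by auto
    have card: "card {0..r+1} = CARD('n)" by (rule is_basis_card[OF fb])
    have ab: "is_basis {0..r+1} a"
      by (rule dual_families_is_basis[OF _ dual_families_sym[OF dual] card]) simp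
    have "trilinear_form T (f i) (f j) (f k) = trilinear_form (cw_tilde_tensor r a a a) (f i) (f j) (f k)"
      if ijk: "i \<in> {0..r+1}" "j \<in> {0..r+1}" "k \<in> {0..r+1}" for i j k
    proof -
      have t: "trilinear_form T (f s) u (f t) = trilinear_form T u (f s) (f t)"
        "trilinear_form T (f s) (f t) u = trilinear_form T u (f s) (f t)"
        "trilinear_form T u (f s) u = trilinear_form T u u (f s)"
        "trilinear_form T (f s) u u = trilinear_form T u u (f s)" for s t
        by (metis s12 s23)+
      have lf: "scalar_product l (f s) = 0" if "s \<in> {1..r+1}" for s
        using that f le lw by (cases "s = r+1") auto
      have ff: "trilinear_form T u (f s) (f t) = (if s = t \<and> s \<in> {1..r} then 1 else 0)"
        if "s \<in> {1..r+1}" "t \<in> {1..r+1}" for s t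
        using that f ee uwe wy[OF lw] by (cases "s = r+1"; cases "t = r+1") auto
      have uf: "trilinear_form T u u (f s) = (if s = r+1 then 1 else 0)"
        if "s \<in> {1..r+1}" for s
        using that f uue uuw by (cases "s = r+1") auto
      have c: "s = 0 \<or> s \<in> {1..r+1}" if "s \<in> {0..r+1}" for s using that by auto
      have z: "f 0 = u" by (rule f)
      show ?thesis
        unfolding trilinear_form_cw_tilde_tensor_dual[OF dual, of i j k, OF ijk[simplified, unfolded Suc_eq_plus1]]
        using c[OF ijk(1)] c[OF ijk(2)] c[OF ijk(3)]
        by (elim disjE) (simp_all add: z t uuu uf ff van lf)
    qed
    then have "T = cw_tilde_tensor r a a a" by (rule tensor_eq_on_basis[OF fb])
    with ab card degenerate[of r a] show thesis by simp
  qed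
qed

section \<open>Strassen's equations and border rank\<close>

text \<open>With as many terms as the dimension, the flattening is the square matrix with columns
  \<open>b s\<close>, times a diagonal matrix, times the matrix with rows \<open>c s\<close>. Only
  the diagonal factor, with entries \<open>scalar_product (a s) x\<close>, depends on
  \<open>x\<close>.\<close>

lemma flat_A_sum_tensor_prod:
  "flat_A (\<Sum>s\<in>UNIV. tensor_prod (a s) (b s) (c s)) x =
     (\<chi> j s. b s $ j) ** (\<chi> s. scalar_product (a s) x *s c s)"
  for a b c :: "'n::finite \<Rightarrow> complex^'n"
proof -
  have "(\<Sum>i\<in>UNIV. x $ i * (\<Sum>s\<in>UNIV. a s $ i * b s $ j * c s $ k)) =
      (\<Sum>s\<in>UNIV. b s $ j * ((\<Sum>i\<in>UNIV. a s $ i * x $ i) * c s $ k))" for j k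
    unfolding sum_distrib_left sum_distrib_right
    by (subst sum.swap) (simp only: mult_ac)
  then show ?thesis
    by (simp add: vec_eq_iff flat_A_def tensor_prod_def matrix_matrix_mult_def scalar_product_def)
qed

text \<open>Padding with zero terms and indexing by the coordinate type makes the factor matrices
  square; a vanishing \<open>a s\<close> remembers that the original sum was shorter.\<close>

lemma sums_of_rank_one_reindex:
  assumes T: "(T :: 'n::finite tensor3) \<in> sums_of_rank_one r" and r: "r \<le> CARD('n)"
  obtains a b c :: "'n \<Rightarrow> complex^'n" where
    "T = (\<Sum>s\<in>UNIV. tensor_prod (a s) (b s) (c s))" "r < CARD('n) \<Longrightarrow> \<exists>s. a s = 0"
proof -
  obtain a b c where T: "T = (\<Sum>s<r. tensor_prod (a s) (b s) (c s))"
    using T by (auto simp: sums_of_rank_one_def)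
  obtain h :: "'n \<Rightarrow> nat" where h: "bij_betw h UNIV {..<CARD('n)}"
    using ex_bij_betw_finite_nat[of "UNIV :: 'n set"] by (auto simp: atLeast0LessThan)
  define a' where "a' = (\<lambda>i. if i < r then a i else 0)"
  have "T = (\<Sum>s<r. tensor_prod (a' s) (b s) (c s))"
    by (simp add: T a'_def)
  also have "\<dots> = (\<Sum>s<CARD('n). tensor_prod (a' s) (b s) (c s))"
    by (rule sum.mono_neutral_left) (use r in \<open>auto simp: a'_def tensor_prod_def vec_eq_iff\<close>)
  also have "\<dots> = (\<Sum>s\<in>UNIV. tensor_prod (a' (h s)) (b (h s)) (c (h s)))"
    by (rule sum.reindex_bij_betw[OF h, symmetric])
  finally have "T = \<dots>" .
  moreover have "\<exists>s. a' (h s) = 0" if "r < CARD('n)"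
  proof -
    have "r \<in> range h" using h that by (simp add: bij_betw_def)
    then show ?thesis by (auto simp: a'_def)
  qed
  ultimately show thesis by (rule that)
qed

lemma continuous_on_det_entries:
  fixes f :: "'b::topological_space \<Rightarrow> complex^'n::finite^'n"
  assumes "\<And>i j. continuous_on S (\<lambda>x. f x $ i $ j)"
  shows "continuous_on S (\<lambda>x. det (f x))"
  unfolding det_def by (intro continuous_intros assms)

lemma continuous_on_flat_A_entry:
  "continuous_on S (\<lambda>T. flat_A T x $ j $ k)"
  unfolding flat_A_def vec_lambda_beta by (intro continuous_intros)

lemma continuous_on_det_flat_A: "continuous_on S (\<lambda>T. det (flat_A T x))"
  by (intro continuous_on_det_entries continuous_on_flat_A_entry)

text \<open>A shorter sum has a zero row in the second factor of its flattening, and vanishing of a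
  determinant is a closed condition. An invertible flattening thus bounds the border rank from
  below.\<close>

lemma det_flat_A_eq_0:
  assumes T: "(T :: 'n::finite tensor3) \<in> closure (sums_of_rank_one r)" and r: "r < CARD('n)"
  shows "det (flat_A T x) = 0"
proof -
  have "det (flat_A S x) = 0" if S_in: "S \<in> sums_of_rank_one r" for S :: "'n tensor3"
  proof -
    obtain a b c :: "'n \<Rightarrow> complex^'n" where
      S: "S = (\<Sum>s\<in>UNIV. tensor_prod (a s) (b s) (c s))" and "\<exists>s. a s = 0"
      by (rule sums_of_rank_one_reindex[OF S_in less_imp_le[OF r]]) (use r in blast)
    then obtain s where s: "a s = 0" by blast
    have "det (\<chi> s. scalar_product (a s) x *s c s) = 0"
      by (rule det_zero_row(1)[of s]) (simp add: row_def s vec_eq_iff)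
    then show ?thesis by (simp add: S flat_A_sum_tensor_prod det_mul)
  qed
  then have "closure (sums_of_rank_one r) \<subseteq> {T :: 'n tensor3. det (flat_A T x) = 0}"
    by (intro closure_minimal closed_Collect_eq continuous_on_det_flat_A continuous_on_const) auto
  then show ?thesis using T by auto
qed

text \<open>The diagonal factors that belong to \<open>x\<close>, \<open>y\<close> and
  \<open>z\<close> commute. The solutions \<open>u\<close> and \<open>u'\<close> of linear systems
  stand in for the inverse of the flattening at \<open>x\<close>; after cancelling the common left
  factor the claim is checked for each \<open>s\<close>.\<close>

lemma strassen_sum:
  fixes a b c :: "'n::finite \<Rightarrow> complex^'n"
  defines "T \<equiv> \<Sum>s\<in>UNIV. tensor_prod (a s) (b s) (c s)"
  assumes det: "det (flat_A T x) \<noteq> 0"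
    and u: "flat_A T x *v u = flat_A T z *v p" and u': "flat_A T x *v u' = flat_A T y *v p"
  shows "flat_A T y *v u = flat_A T z *v u'"
proof -
  define B :: "complex^'n^'n" where "B = (\<chi> j s. b s $ j)"
  have fl: "flat_A T y *v v = B *v (\<chi> s. scalar_product (a s) y * scalar_product (c s) v)" for y v
    unfolding T_def flat_A_sum_tensor_prod B_def[symmetric] matrix_vector_mul_assoc[symmetric]
    by (rule arg_cong[where f = "\<lambda>w. B *v w"])
      (simp add: vec_eq_iff matrix_vector_mult_def scalar_product_def sum_distrib_left mult.assoc)
  have "det B \<noteq> 0" and prod: "(\<Prod>s\<in>UNIV. scalar_product (a s) x) \<noteq> 0"
    using det unfolding T_def flat_A_sum_tensor_prod B_def[symmetric] det_mul det_rows_mul by auto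
  then have injB: "v = w" if "B *v v = B *v w" for v w
    using that by (metis eq_iff_diff_eq_0 det_nonzero_iff_kernel matrix_vector_mult_diff_distrib)
  have ax: "scalar_product (a s) x \<noteq> 0" for s using prod by simp
  have U: "scalar_product (a s) x * scalar_product (c s) u = scalar_product (a s) z * scalar_product (c s) p" for s
    using injB[OF u[unfolded fl]] by (simp add: vec_eq_iff)
  have U': "scalar_product (a s) x * scalar_product (c s) u' = scalar_product (a s) y * scalar_product (c s) p" for s
    using injB[OF u'[unfolded fl]] by (simp add: vec_eq_iff)
  have "scalar_product (a s) y * scalar_product (c s) u = scalar_product (a s) z * scalar_product (c s) u'" for s
  proof -
    have "scalar_product (a s) x * (scalar_product (a s) y * scalar_product (c s) u) =
        scalar_product (a s) x * (scalar_product (a s) z * scalar_product (c s) u')"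
      using U[of s] U'[of s] by (metis mult.left_commute)
    then show ?thesis using ax by simp
  qed
  then show ?thesis unfolding fl by simp
qed

text \<open>This is the adjugate of \<open>M\<close> applied to \<open>v\<close>, polynomial in the
  entries and hence continuous even where \<open>M\<close> is singular.\<close>

definition cramer_vec :: "complex^'n::finite^'n \<Rightarrow> complex^'n \<Rightarrow> complex^'n" where
  "cramer_vec M v = (\<chi> k. det (\<chi> i j. if j = k then v $ i else M $ i $ j))"

lemma cramer_vec_solves:
  assumes "det M \<noteq> 0"
  shows "M *v w = v \<longleftrightarrow> cramer_vec M v = det M *s w"
  using cramer[OF assms, of w v] assms by (auto simp: cramer_vec_def vec_eq_iff field_simps)

text \<open>
  Strassen's equations: with \<open>X, Y, Z\<close> the flattenings at \<open>y, x, z\<close>, they say that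
  \<open>X Y\<^sup>-\<^sup>1 Z = Z Y\<^sup>-\<^sup>1 X\<close> at \<open>p\<close>. Cramer's rule clears the denominators, which makes the condition closed.
\<close>

lemma strassen_closure:
  assumes T: "(T :: 'n::finite tensor3) \<in> closure (sums_of_rank_one CARD('n))"
    and det: "det (flat_A T x) \<noteq> 0"
    and u: "flat_A T x *v u = flat_A T z *v p" and u': "flat_A T x *v u' = flat_A T y *v p"
  shows "flat_A T y *v u = flat_A T z *v u'"
proof -
  define F where "F S = flat_A S y *v cramer_vec (flat_A S x) (flat_A S z *v p)" for S :: "'n tensor3"
  define G where "G S = flat_A S z *v cramer_vec (flat_A S x) (flat_A S y *v p)" for S :: "'n tensor3"
  have cont: "continuous_on UNIV (\<lambda>S. (flat_A S y' *v cramer_vec (flat_A S x) (flat_A S z' *v p)) $ k)"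
    for y' z' k
  proof -
    have if_cont: "continuous_on UNIV (\<lambda>S. if Q then f S else g S)"
      if "continuous_on UNIV f" "continuous_on UNIV g" for Q and f g :: "'n tensor3 \<Rightarrow> complex"
      using that by (cases Q) auto
    show ?thesis
      unfolding matrix_vector_mult_def cramer_vec_def vec_lambda_beta
      by (intro continuous_intros continuous_on_flat_A_entry continuous_on_det_entries)
        (simp, intro if_cont continuous_intros continuous_on_flat_A_entry)
  qed
  have "F S = G S" if S: "S \<in> sums_of_rank_one CARD('n)" and d: "det (flat_A S x) \<noteq> 0" for S
  proof -
    obtain a b c :: "'n \<Rightarrow> complex^'n" where Seq: "S = (\<Sum>s\<in>UNIV. tensor_prod (a s) (b s) (c s))"
      using sums_of_rank_one_reindex[OF S order_refl] by blast
    define v where "v z = (1 / det (flat_A S x)) *s cramer_vec (flat_A S x) (flat_A S z *v p)" for z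
    have cv: "cramer_vec (flat_A S x) (flat_A S z *v p) = det (flat_A S x) *s v z" for z
      using d by (simp add: v_def)
    then have "flat_A S x *v v z = flat_A S z *v p" for z
      using cramer_vec_solves[OF d] by blast
    then have "flat_A S y *v v z = flat_A S z *v v y"
      using strassen_sum[of a b c x "v z" z p "v y" y] d unfolding Seq[symmetric] by blast
    then show ?thesis by (simp add: F_def G_def cv vector_scalar_commute)
  qed
  \<comment> \<open>The factor \<open>det (flat_A S x)\<close> makes the equation trivial where the
    flattening is singular, so it holds on all of \<open>sums_of_rank_one\<close> and passes to the
    closure; it is cancelled only at \<open>T\<close>.\<close>
  then have sub: "sums_of_rank_one CARD('n) \<subseteq>
      {S. \<forall>k. det (flat_A S x) * F S $ k = det (flat_A S x) * G S $ k}" by auto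
  have "closed {S. \<forall>k. det (flat_A S x) * F S $ k = det (flat_A S x) * G S $ k}"
    unfolding F_def G_def
    by (intro closed_Collect_all closed_Collect_eq continuous_on_mult continuous_on_det_flat_A cont)
  from closure_minimal[OF sub this] T det have "F T = G T" by (auto simp: vec_eq_iff)
  then show ?thesis
    using u u' det by (simp add: F_def G_def cramer_vec_solves vector_scalar_commute)
qed

section \<open>Border rank: attainment, bounds and the degeneration to the tilde tensor\<close>

lemma sums_of_rank_one_add:
  assumes "S \<in> sums_of_rank_one r" "T \<in> sums_of_rank_one q"
  shows "S + T \<in> sums_of_rank_one (r + q)"
proof -
  obtain a b c a' b' c' where S: "S = (\<Sum>s<r. tensor_prod (a s) (b s) (c s))"
    and T: "T = (\<Sum>s<q. tensor_prod (a' s) (b' s) (c' s))"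
    using assms by (auto simp: sums_of_rank_one_def)
  define j where "j f g s = (if s < r then f s else g (s - r))" for f g :: "nat \<Rightarrow> complex^'a" and s
  have "(\<Sum>s<r + q. tensor_prod (j a a' s) (j b b' s) (j c c' s)) = S + T"
    unfolding S T lessThan_atLeast0 sum.atLeastLessThan_concat[of 0 r "r + q", simplified, symmetric]
    using sum.shift_bounds_nat_ivl[of "\<lambda>s. tensor_prod (j a a' s) (j b b' s) (j c c' s)" 0 r q]
    by (simp add: j_def add.commute)
  then show ?thesis
    unfolding sums_of_rank_one_def
    by (intro CollectI exI[of _ "j a a'"] exI[of _ "j b b'"] exI[of _ "j c c'"]) simp
qed

text \<open>Expansion in the standard basis. It guarantees that the \<open>LEAST\<close> in
  \<open>border_rank\<close> is attained.\<close>

lemma sums_of_rank_one_exists: "\<exists>r. T \<in> sums_of_rank_one r"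
proof -
  have 0: "\<exists>r. 0 \<in> sums_of_rank_one r"
    by (rule exI[of _ 0]) (simp add: sums_of_rank_one_def)
  have 1: "\<exists>r. tensor_prod a b c \<in> sums_of_rank_one r" for a b c :: "complex^'a"
    by (rule exI[of _ 1], unfold sums_of_rank_one_def, rule CollectI)
      (rule exI[of _ "\<lambda>_. a"], rule exI[of _ "\<lambda>_. b"], rule exI[of _ "\<lambda>_. c"], simp)
  have sum: "\<exists>r. (\<Sum>i\<in>I. f i) \<in> sums_of_rank_one r"
    if "\<And>i. \<exists>r. f i \<in> sums_of_rank_one r" for f :: "'a \<Rightarrow> 'a tensor3" and I
    by (induction I rule: infinite_finite_induct) (use 0 that sums_of_rank_one_add in \<open>auto, blast\<close>)
  define T' where
    "T' = (\<Sum>i\<in>UNIV. \<Sum>j\<in>UNIV. \<Sum>k\<in>UNIV. tensor_prod (T $ i $ j $ k *s axis i 1) (axis j 1) (axis k 1))"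
  have "scalar_product (axis i 1) x = x $ i" for i and x :: "complex^'a"
    by (metis scalar_product_axis_right scalar_product_commute)
  then have "trilinear_form T x y z = trilinear_form T' x y z" for x y z
    unfolding T'_def trilinear_form_tensor_sum trilinear_form_tensor_prod scalar_product_scale_left
    by (simp add: trilinear_form_def mult_ac)
  then have "T = T'" by (metis trilinear_form_axis vec_eq_iff)
  moreover have "\<exists>r. T' \<in> sums_of_rank_one r"
    unfolding T'_def by (intro sum 1)
  ultimately show ?thesis by simp
qed

lemma border_rank_closure: "T \<in> closure (sums_of_rank_one (border_rank T))"
proof -
  obtain r where "T \<in> sums_of_rank_one r" using sums_of_rank_one_exists by blast
  then have "T \<in> closure (sums_of_rank_one r)" using closure_subset by blast
  then show ?thesis unfolding border_rank_def by (rule LeastI)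
qed

lemma border_rank_eqI:
  assumes T: "(T :: 'n::finite tensor3) \<in> closure (sums_of_rank_one CARD('n))"
    and x: "det (flat_A T x) \<noteq> 0"
  shows "border_rank T = CARD('n)"
proof (rule antisym)
  show "border_rank T \<le> CARD('n)"
    unfolding border_rank_def using T by (rule Least_le)
  show "CARD('n) \<le> border_rank T"
    using det_flat_A_eq_0[OF border_rank_closure] x by (metis not_le)
qed

text \<open>
  The curve \<open>\<epsilon>\<^sup>-\<^sup>2 \<Sum>\<^sub>j (a\<^sub>0 + \<epsilon>a\<^sub>j)\<^sup>3 - \<epsilon>\<^sup>-\<^sup>3 (a\<^sub>0 + \<epsilon>\<^sup>2 \<Sum>\<^sub>j a\<^sub>j)\<^sup>3 + (\<epsilon>\<^sup>-\<^sup>3 - q\<epsilon>\<^sup>-\<^sup>2) (a\<^sub>0 + \<epsilon>\<^sup>3 a\<^sub>q\<^sub>+\<^sub>1)\<^sup>3\<close>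
  of tensors of rank at most \<open>q + 2\<close> is polynomial in \<open>\<epsilon>\<close>, with constant term the tensor below.
\<close>

lemma cw_tilde_tensor_border_rank_le:
  "(cw_tilde_tensor q a a a :: 'n::finite tensor3) \<in> closure (sums_of_rank_one (q + 2))"
proof -
  define S where "S = (\<Sum>j=1..q. a j)"
  \<comment> \<open>The product \<open>\<epsilon> * E \<epsilon>\<close> is the part of the curve
    that tends to zero, with the powers of \<open>\<epsilon>\<close> collected. Defining
    \<open>F\<close> through \<open>E\<close> makes it continuous at 0, where the weights of the
    rank-one terms have poles.\<close>
  define E where "E \<epsilon> = (\<Sum>j=1..q. tensor_prod (a j) (a j) (a j))
      - (tensor_prod (a 0) S S + tensor_prod S (a 0) S + tensor_prod S S (a 0))
      - tensor_prod (\<epsilon>^2 *s S) S S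
      - tensor_prod (of_nat q *s a 0) (a 0) (a (q+1)) - tensor_prod (of_nat q *s a 0) (a (q+1)) (a 0)
      - tensor_prod (of_nat q *s a (q+1)) (a 0) (a 0)
      + tensor_prod ((1 - of_nat q * \<epsilon>) *s (\<epsilon>^2 *s a 0)) (a (q+1)) (a (q+1))
      + tensor_prod ((1 - of_nat q * \<epsilon>) *s (\<epsilon>^2 *s a (q+1))) (a 0) (a (q+1))
      + tensor_prod ((1 - of_nat q * \<epsilon>) *s (\<epsilon>^2 *s a (q+1))) (a (q+1)) (a 0)
      + tensor_prod ((1 - of_nat q * \<epsilon>) *s (\<epsilon>^5 *s a (q+1))) (a (q+1)) (a (q+1))"
    for \<epsilon> :: complex
  define F where "F \<epsilon> = cw_tilde_tensor q a a a + (\<chi> i j k. \<epsilon> * E \<epsilon> $ i $ j $ k)" for \<epsilon>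
  have Fin: "F \<epsilon> \<in> sums_of_rank_one (q + 2)" if e: "\<epsilon> \<noteq> 0" for \<epsilon>
  proof -
    \<comment> \<open>Index 0 carries the sum \<open>S\<close>, the indices \<open>1..q\<close> the
      single vectors, and \<open>q + 1\<close> the vector \<open>a (q+1)\<close>. The weights
      \<open>w\<close> are such that all negative powers of \<open>\<epsilon>\<close>
      cancel.\<close>
    define t where "t s = (if s = 0 then a 0 + \<epsilon>^2 *s S else if s \<le> q then a 0 + \<epsilon> *s a s
        else a 0 + \<epsilon>^3 *s a (q+1))" for s
    define w where "w s = (if s = 0 then - 1 / \<epsilon>^3 else if s \<le> q then 1 / \<epsilon>^2
        else 1 / \<epsilon>^3 - of_nat q / \<epsilon>^2)" for s
    have "F \<epsilon> $ i $ j $ k = (\<Sum>s<q+2. tensor_prod (w s *s t s) (t s) (t s)) $ i $ j $ k" for i j k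
    proof -
      define p where "p s = w s * t s $ i * t s $ j * t s $ k" for s
      have set: "{..<q+2} = insert 0 (insert (q+1) {1..q})" by auto
      define x y z where "x s = a s $ i" and "y s = a s $ j" and "z s = a s $ k" for s
      have S: "S $ i = sum x {1..q}" "S $ j = sum y {1..q}" "S $ k = sum z {1..q}"
        by (simp_all add: S_def x_def y_def z_def)
      have "(\<Sum>s\<in>{1..q}. p s) = (\<Sum>s\<in>{1..q}. (1 / \<epsilon>^2) * (x 0 * y 0 * z 0)
          + (1 / \<epsilon>) * (x 0 * y 0 * z s + x 0 * z 0 * y s + y 0 * z 0 * x s)
          + (x 0 * (y s * z s) + y 0 * (x s * z s) + z 0 * (x s * y s)) + \<epsilon> * (x s * y s * z s))"
        by (rule sum.cong)
          (use e in \<open>auto simp: p_def w_def t_def x_def y_def z_def field_simps power2_eq_square\<close>)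
      also have "\<dots> = (of_nat q / \<epsilon>^2) * (x 0 * y 0 * z 0)
          + (1 / \<epsilon>) * (x 0 * y 0 * sum z {1..q} + x 0 * z 0 * sum y {1..q} + y 0 * z 0 * sum x {1..q})
          + (x 0 * (\<Sum>s=1..q. y s * z s) + y 0 * (\<Sum>s=1..q. x s * z s) + z 0 * (\<Sum>s=1..q. x s * y s))
          + \<epsilon> * (\<Sum>s=1..q. x s * y s * z s)"
        by (simp add: sum.distrib sum_distrib_left algebra_simps)
      finally have mid: "(\<Sum>s\<in>{1..q}. p s) = \<dots>" .
      have p0: "p 0 = - 1 / \<epsilon>^3 * ((x 0 + \<epsilon>^2 * sum x {1..q}) * (y 0 + \<epsilon>^2 * sum y {1..q}) * (z 0 + \<epsilon>^2 * sum z {1..q}))"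
        by (simp add: p_def w_def t_def S x_def y_def z_def)
      have pq: "p (q+1) = (1 / \<epsilon>^3 - of_nat q / \<epsilon>^2) *
          ((x 0 + \<epsilon>^3 * x (q+1)) * (y 0 + \<epsilon>^3 * y (q+1)) * (z 0 + \<epsilon>^3 * z (q+1)))"
        by (simp add: p_def w_def t_def x_def y_def z_def)
      have "(\<Sum>s<q+2. tensor_prod (w s *s t s) (t s) (t s)) $ i $ j $ k = (\<Sum>s<q+2. p s)"
        by (simp add: tensor_prod_def p_def)
      also have "\<dots> = p 0 + p (q+1) + (\<Sum>s\<in>{1..q}. p s)"
        unfolding set by simp
      also have "\<dots> = F \<epsilon> $ i $ j $ k"
      proof -
        have cw: "cw_tilde_tensor q a a a $ i $ j $ k =
            x 0 * (\<Sum>s=1..q. y s * z s) + y 0 * (\<Sum>s=1..q. x s * z s) + z 0 * (\<Sum>s=1..q. x s * y s)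
            + x 0 * y 0 * z (q+1) + x 0 * y (q+1) * z 0 + x (q+1) * y 0 * z 0"
          by (simp add: cw_tilde_tensor_def tensor_prod_def x_def y_def z_def sum.distrib
              sum_distrib_left mult_ac)
        have Ee: "E \<epsilon> $ i $ j $ k = (\<Sum>s=1..q. x s * y s * z s)
            - (x 0 * sum y {1..q} * sum z {1..q} + sum x {1..q} * y 0 * sum z {1..q} + sum x {1..q} * sum y {1..q} * z 0)
            - \<epsilon>^2 * sum x {1..q} * sum y {1..q} * sum z {1..q}
            - of_nat q * x 0 * y 0 * z (q+1) - of_nat q * x 0 * y (q+1) * z 0 - of_nat q * x (q+1) * y 0 * z 0
            + (1 - of_nat q * \<epsilon>) * (\<epsilon>^2 * x 0) * y (q+1) * z (q+1)
            + (1 - of_nat q * \<epsilon>) * (\<epsilon>^2 * x (q+1)) * y 0 * z (q+1)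
            + (1 - of_nat q * \<epsilon>) * (\<epsilon>^2 * x (q+1)) * y (q+1) * z 0
            + (1 - of_nat q * \<epsilon>) * (\<epsilon>^5 * x (q+1)) * y (q+1) * z (q+1)"
          by (simp add: E_def tensor_prod_def S flip: x_def y_def z_def)
        define X Y Z XY XZ YZ W where "X = sum x {1..q}" and "Y = sum y {1..q}" and "Z = sum z {1..q}"
          and "XY = (\<Sum>s=1..q. x s * y s)" and "XZ = (\<Sum>s=1..q. x s * z s)"
          and "YZ = (\<Sum>s=1..q. y s * z s)" and "W = (\<Sum>s=1..q. x s * y s * z s)"
        note abb = X_def[symmetric] Y_def[symmetric] Z_def[symmetric] XY_def[symmetric]
          XZ_def[symmetric] YZ_def[symmetric] W_def[symmetric]
        \<comment> \<open>Multiplication by \<open>\<epsilon>^3\<close> clears all denominators;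
          with the sums abbreviated, a polynomial identity remains.\<close>
        have "\<epsilon>^3 * (p 0 + p (q+1) + (\<Sum>s\<in>{1..q}. p s)) = \<epsilon>^3 * (F \<epsilon> $ i $ j $ k)"
        proof -
          have d: "\<epsilon>^3 * (- 1 / \<epsilon>^3 * A) = - A" "\<epsilon>^3 * ((1 / \<epsilon>^3 - of_nat q / \<epsilon>^2) * A) = (1 - of_nat q * \<epsilon>) * A"
            "\<epsilon>^3 * (of_nat q / \<epsilon>^2 * A) = of_nat q * \<epsilon> * A" "\<epsilon>^3 * (1 / \<epsilon> * A) = \<epsilon>^2 * A" for A
            using e by (simp_all add: field_simps power2_eq_square power3_eq_cube)
          have "F \<epsilon> $ i $ j $ k = cw_tilde_tensor q a a a $ i $ j $ k + \<epsilon> * E \<epsilon> $ i $ j $ k"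
            by (simp add: F_def tensor_prod_def)
          then show ?thesis
            unfolding mid p0 pq cw Ee abb distrib_left[of "\<epsilon>^3"] d
            by algebra
        qed
        then show ?thesis using e by simp
      qed
      finally show ?thesis by simp
    qed
    then have "F \<epsilon> = (\<Sum>s<q+2. tensor_prod (w s *s t s) (t s) (t s))" by (simp add: vec_eq_iff)
    then show ?thesis
      unfolding sums_of_rank_one_def
      by (intro CollectI exI[of _ "\<lambda>s. w s *s t s"] exI[of _ t]) simp
  qed
  have "continuous_on UNIV (\<lambda>\<epsilon>. F \<epsilon> $ i $ j $ k)" for i j k
    unfolding F_def E_def by (simp add: tensor_prod_def) (intro continuous_intros)
  then have "continuous_on UNIV (\<lambda>\<epsilon>. \<chi> i j k. F \<epsilon> $ i $ j $ k)"
    by (intro continuous_on_vec_lambda)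
  then have "continuous_on UNIV F" by simp
  then have "(F \<longlongrightarrow> F 0) (at 0)"
    by (simp add: continuous_on_eq_continuous_at isCont_def)
  moreover have "\<forall>\<^sub>F \<epsilon> in at 0. F \<epsilon> \<in> closure (sums_of_rank_one (q + 2))"
    unfolding eventually_at_filter
    by (rule always_eventually) (use Fin closure_subset in blast)
  ultimately have "F 0 \<in> closure (sums_of_rank_one (q + 2))"
    by (intro Lim_in_closed_set[of _ F "at 0"]) auto
  moreover have "F 0 = cw_tilde_tensor q a a a"
    by (simp add: F_def vec_eq_iff tensor_prod_def)
  ultimately show ?thesis by simp
qed

section \<open>Changes of basis, and excess border rank of the nondegenerate normal form\<close>

lemma is_basis_scale:
  assumes a: "is_basis I (a :: nat \<Rightarrow> complex^'n::finite)" and fin: "finite I" and k: "\<And>i. i \<in> I \<Longrightarrow> k i \<noteq> 0"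
  shows "is_basis I (\<lambda>i. k i *s a i)"
proof -
  obtain e where "dual_families I a e" by (rule is_basis_dual[OF a fin])
  then have "dual_families I (\<lambda>i. (1 / k i) *s e i) (\<lambda>i. k i *s a i)"
    using k by (auto simp: dual_families_def scalar_product_simps scalar_product_commute[of "e _"])
  then show ?thesis by (rule dual_families_is_basis[OF fin _ is_basis_card[OF a]])
qed

text \<open>The Coppersmith-Winograd tensors count basis vectors from 0,
  \<open>linear_times_quadric\<close> from 1.\<close>

lemma is_basis_shift:
  assumes "is_basis {0..r} a"
  shows "is_basis {1..r+1} (\<lambda>j. a (j - 1))"
proof -
  have h: "bij_betw (\<lambda>j. j - 1) {1..r+1} {0..r}"
    by (rule bij_betw_byWitness[where f' = Suc]) auto
  have "bij_betw a {0..r} (a ` {0..r})"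
    using assms by (simp add: is_basis_def bij_betw_def)
  from bij_betw_trans[OF h this] show ?thesis
    using assms by (simp add: is_basis_def bij_betw_def comp_def)
qed

text \<open>The existentially quantified bases of the classification absorb all linear changes of
  coordinates, so the identity is the only isomorphism required.\<close>

lemma tensor_isomorphic_refl: "tensor_isomorphic T T"
proof -
  have "mat 1 $ i = (axis i 1 :: complex^'a)" for i
    by (auto simp: mat_def axis_def vec_eq_iff)
  then have "gl_act (mat 1) (mat 1) (mat 1) T = T"
    unfolding gl_act_def trilinear_form_def[symmetric] by (simp add: trilinear_form_axis)
  moreover have "T \<in> factor_permutations T" by (simp add: factor_permutations_def)
  moreover have "invertible (mat 1 :: complex^'a^'a)" by (simp add: invertible_det_nz)
  ultimately show ?thesis unfolding tensor_isomorphic_def by metis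
qed

text \<open>Strassen's equations are tested with \<open>e 1\<close>, \<open>e 2\<close> and
  \<open>p = e 2\<close>. The quadratic form is diagonal, so the flattening at \<open>e 2\<close>
  sends \<open>e 2\<close> to a nonzero vector while the one at \<open>e 1\<close> sends it to zero,
  and the two sides differ. This takes two orthogonal directions, hence
  \<open>2 \<le> r\<close>.\<close>

lemma nondegenerate_not_border_rank_le:
  fixes a :: "nat \<Rightarrow> complex^'n::finite" and c :: complex
  assumes a: "is_basis {0..r} a" and card: "r + 1 = CARD('n)" and r: "2 \<le> r"
  defines "T \<equiv> tensor_prod (c *s a 0) (a 0) (a 0) + cw_tensor r a a a"
  shows "T \<notin> closure (sums_of_rank_one CARD('n))"
proof
  assume T: "T \<in> closure (sums_of_rank_one CARD('n))"
  obtain e where e: "is_basis {0..r} e" and dual: "dual_families {0..r} a e"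
    by (rule is_basis_dual[OF a]) auto
  have sp: "scalar_product (a i) (e j) = (if i = j then 1 else 0)" if "i \<le> r" "j \<le> r" for i j
    using dual that by (auto simp: dual_families_def)
  have delta: "(\<Sum>s=1..r. g s * scalar_product (a s) (e k)) = (if k = 0 then 0 else g k)"
    "(\<Sum>s=1..r. scalar_product (a s) (e k) * g s) = (if k = 0 then 0 else g k)" if "k \<le> r" for g k
  proof -
    have "(\<Sum>s=1..r. g s * scalar_product (a s) (e k)) = (\<Sum>s=1..r. if k = s then g s else 0)"
      by (rule sum.cong) (use that in \<open>auto simp: sp\<close>)
    then show *: "(\<Sum>s=1..r. g s * scalar_product (a s) (e k)) = (if k = 0 then 0 else g k)"
      using that by auto
    then show "(\<Sum>s=1..r. scalar_product (a s) (e k) * g s) = (if k = 0 then 0 else g k)"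
      by (simp add: mult.commute)
  qed
  have form: "trilinear_form T x (e k) z =
      (if k = 0 then c * scalar_product (a 0) x * scalar_product (a 0) z
          + (\<Sum>s=1..r. scalar_product (a s) x * scalar_product (a s) z)
       else scalar_product (a 0) x * scalar_product (a k) z + scalar_product (a 0) z * scalar_product (a k) x)"
    if k: "k \<le> r" for x z k
    unfolding T_def trilinear_form_tensor_add trilinear_form_tensor_prod trilinear_form_cw_tensor
      delta(1)[OF k] delta(2)[OF k]
    using k by (simp add: sp scalar_product_scale_left)
  have eqI: "v = w" if "\<And>k. k \<le> r \<Longrightarrow> scalar_product (e k) v = scalar_product (e k) w" for v w
    using scalar_product_eq_0_on_basis[OF e, of "v - w"] that
    by (simp add: scalar_product_simps)
  \<comment> \<open>On the first two coordinates the flattening at \<open>x\<close> has determinant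
    \<open>c - t\<^sup>2\<close>, and it is the identity on the others. The value
    \<open>t = 0\<close> serves unless \<open>c = 0\<close>, when \<open>t = 1\<close> does.\<close>
  obtain t where t: "c - t\<^sup>2 \<noteq> 0"
    by (cases "c = 0") (use that[of 0] that[of 1] in auto)
  define x where "x = e 0 + t *s e 1"
  define d where "d = 1 / (c - t\<^sup>2)"
  have d: "c * d - t * (t * d) = 1" "d \<noteq> 0"
    using t by (simp_all add: d_def power2_eq_square flip: diff_divide_distrib)
  \<comment> \<open>This solves the system with rows \<open>(c, t)\<close> and \<open>(t, 1)\<close>
    and right-hand side \<open>(1, 0)\<close>, the leading coordinates of
    \<open>flat_A T (e 2) *v e 2\<close>.\<close>
  define u where "u = d *s (e 0 - t *s e 1)"
  have x: "scalar_product (a s) x = (if s = 0 then 1 else if s = 1 then t else 0)" if "s \<le> r" for s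
    using that r by (simp add: x_def scalar_product_simps sp)
  have xz: "(\<Sum>s=1..r. scalar_product (a s) x * g s) = t * g 1" for g
    using delta(2)[of 0 g] delta(2)[of 1 g] r
    by (simp add: x_def scalar_product_simps distrib_right sum.distrib mult.assoc sum_distrib_left[symmetric]
        del: One_nat_def)
  have "det (flat_A T x) \<noteq> 0"
    unfolding det_nonzero_iff_kernel
  proof (intro allI impI)
    fix z assume "flat_A T x *v z = 0"
    then have z: "trilinear_form T x (e k) z = 0" for k
      by (simp add: trilinear_form_flat_A)
    have z0: "c * scalar_product (a 0) z + t * scalar_product (a 1) z = 0"
      using z[of 0, unfolded form[OF le0] xz] by (simp add: x)
    have zk: "scalar_product (a k) z + scalar_product (a 0) z * (if k = 1 then t else 0) = 0"
      if "k \<in> {1..r}" for k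
      using z[of k] that by (simp add: form x)
    have z1: "scalar_product (a 1) z = - scalar_product (a 0) z * t"
      using zk[of 1] r by (simp add: add_eq_0_iff2)
    have "(c - t\<^sup>2) * scalar_product (a 0) z = 0"
      using z0 unfolding z1 by (simp add: algebra_simps power2_eq_square)
    then have a0: "scalar_product (a 0) z = 0" using t by simp
    then have "scalar_product (a k) z = 0" if "k \<in> {0..r}" for k
      using zk[of k] that by (cases "k = 0") auto
    then show "z = 0" by (rule scalar_product_eq_0_on_basis[OF a])
  qed
  moreover have "flat_A T x *v u = flat_A T (e 2) *v e 2"
  proof (rule eqI)
    fix k assume k: "k \<le> r"
    show "scalar_product (e k) (flat_A T x *v u) = scalar_product (e k) (flat_A T (e 2) *v e 2)"
      unfolding trilinear_form_flat_A[symmetric] form[OF k] xz delta(1)[OF r]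
      using k r d(1) by (auto simp: x sp u_def scalar_product_simps mult_ac)
  qed
  moreover have "flat_A T x *v 0 = flat_A T (e 1) *v e 2"
  proof (rule eqI)
    fix k assume k: "k \<le> r"
    show "scalar_product (e k) (flat_A T x *v 0) = scalar_product (e k) (flat_A T (e 1) *v e 2)"
      unfolding trilinear_form_flat_A[symmetric] form[OF k] xz delta(1)[OF r]
      using k r by (auto simp: sp)
  qed
  ultimately have "flat_A T (e 1) *v u = flat_A T (e 2) *v 0"
    by (rule strassen_closure[OF T])
  \<comment> \<open>Pairing with \<open>e 1\<close> isolates the coefficient \<open>d\<close> of
    \<open>e 0\<close> in \<open>u\<close>, which is nonzero.\<close>
  then have "trilinear_form T (e 1) (e 1) u = 0" by (simp add: trilinear_form_flat_A)
  then show False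
    using r d by (simp add: form sp u_def scalar_product_simps)
qed

section \<open>The product of a linear form and a quadric, and its matrix\<close>

lemma sym_prod_entry:
  "sym_prod u v v $ i $ j $ k = (u $ i * v $ j * v $ k + v $ i * u $ j * v $ k + v $ i * v $ j * u $ k) / 3"
proof -
  have sixth: "((1/6) *\<^sub>R X) $ i $ j $ k = X $ i $ j $ k / 6" for X :: "'a tensor3"
    unfolding vector_scaleR_component by (simp add: scaleR_conv_of_real)
  show ?thesis
    unfolding sym_prod_def sixth by (simp add: tensor_prod_def field_simps)
qed

text \<open>The cubic of the given tensor is \<open>c x_0^3 + 3 x_0 (x_1^2 + ... + x_r^2)\<close>,
  since each mixed monomial occurs in three orders. Scaling \<open>a 0\<close> by
  \<open>\<kappa>\<close> and the other vectors by \<open>\<mu>\<close> therefore has to meet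
  \<open>\<kappa>^3 = c\<close> and \<open>\<kappa> * \<mu>^2 = 3\<close>.\<close>

lemma nondegenerate_linear_times_quadric:
  fixes a :: "nat \<Rightarrow> complex^'n::finite" and c :: complex
  assumes a: "is_basis {0..r} a" and c: "c \<noteq> 0"
  obtains a' where "is_basis {1..r+1} a'"
    "tensor_prod (c *s a 0) (a 0) (a 0) + cw_tensor r a a a = linear_times_quadric (r + 1) a'"
proof -
  define \<kappa> where "\<kappa> = exp (Ln c / 3)"
  have \<kappa>: "\<kappa> * \<kappa> * \<kappa> = c" "\<kappa> \<noteq> 0"
    using c by (simp_all add: \<kappa>_def flip: exp_add)
  define \<mu> where "\<mu> = csqrt (3 / \<kappa>)"
  have \<mu>: "\<mu> * \<mu> = 3 / \<kappa>" by (simp add: \<mu>_def flip: power2_eq_square)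
  then have "\<mu> \<noteq> 0" using \<kappa>(2) by auto
  define a' where "a' j = (if j = 1 then \<kappa> else \<mu>) *s a (j - 1)" for j
  have "is_basis {1..r+1} a'"
    unfolding a'_def by (rule is_basis_scale[OF is_basis_shift[OF a]]) (use \<kappa> \<open>\<mu> \<noteq> 0\<close> in auto)
  moreover have "tensor_prod (c *s a 0) (a 0) (a 0) + cw_tensor r a a a = linear_times_quadric (r + 1) a'"
  proof -
    have first: "sym_prod (a' 1) (a' 1) (a' 1) = tensor_prod (c *s a 0) (a 0) (a 0)"
      by (simp add: vec_eq_iff sym_prod_entry a'_def tensor_prod_def flip: \<kappa>(1))
    have rest: "sym_prod (a' 1) (a' (Suc j)) (a' (Suc j)) = tensor_prod (a 0) (a j) (a j)
        + tensor_prod (a j) (a 0) (a j) + tensor_prod (a j) (a j) (a 0)" if "j \<in> {1..r}" for j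
    proof -
      have k: "\<kappa> * \<mu> * \<mu> = 3" using \<mu> \<kappa>(2) by (simp add: mult.assoc)
      have "\<kappa> * x * (\<mu> * y) * (\<mu> * z) + \<mu> * x' * (\<kappa> * y') * (\<mu> * z') + \<mu> * x'' * (\<mu> * y'') * (\<kappa> * z'')
          = 3 * (x * y * z + x' * y' * z' + x'' * y'' * z'')" for x y z x' y' z' x'' y'' z''
        unfolding k[symmetric] by (simp add: algebra_simps)
      then show ?thesis
        using that by (simp add: vec_eq_iff sym_prod_entry a'_def tensor_prod_def)
    qed
    have "linear_times_quadric (r + 1) a' = sym_prod (a' 1) (a' 1) (a' 1)
        + (\<Sum>j=1..r. sym_prod (a' 1) (a' (Suc j)) (a' (Suc j)))"
      unfolding linear_times_quadric_def
      by (subst sum.atLeast_Suc_atMost) (simp_all add: sum.shift_bounds_cl_Suc_ivl del: sum.cl_ivl_Suc)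
    then show ?thesis
      unfolding cw_tensor_def first using rest by simp
  qed
  ultimately show thesis by (rule that)
qed

text \<open>With \<open>y_j = scalar_product (a j) x\<close>, the matrix in the basis
  \<open>a\<close> has \<open>y_1\<close> in the corner, \<open>y_q / 3\<close> along the first row
  and column, and \<open>y_1 / 3\<close> on the rest of the diagonal. Scaling all basis vectors but
  the first by \<open>\<sigma>\<close> removes the thirds from the diagonal; the factor left in the
  first row and column goes into the parameters.\<close>

lemma flat_A_linear_times_quadric:
  fixes a :: "nat \<Rightarrow> complex^'n::finite" and \<sigma> :: complex
  assumes m: "1 \<le> m" and \<sigma>: "\<sigma> * \<sigma> = 1 / 3"
  defines "f \<equiv> \<lambda>j. (if j = 1 then 1 else \<sigma>) *s a j"
  shows "flat_A (linear_times_quadric m a) x = matrix_in_bases m f f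
    (arrow_entry (\<lambda>j. (if j = 1 then 1 else \<sigma>) * scalar_product (a j) x))"
proof -
  define y where "y j = scalar_product (a j) x" for j
  define D where "D = arrow_entry (\<lambda>j. (if j = 1 then 1 else \<sigma>) * y j)"
  have "flat_A (linear_times_quadric m a) x $ j $ k = matrix_in_bases m f f D $ j $ k" for j k
  proof -
    define b d where "b s = a s $ j" and "d s = a s $ k" for s
    have split: "(\<Sum>p=1..m. g p) = g 1 + (\<Sum>p=2..m. g p)" for g :: "nat \<Rightarrow> complex"
      using m by (subst sum.atLeast_Suc_atMost) (simp_all add: numeral_2_eq_2)
    have one: "(\<Sum>i\<in>UNIV. x $ i * sym_prod (a 1) (a s) (a s) $ i $ j $ k) =
        (y 1 * b s * d s + y s * b 1 * d s + y s * b s * d 1) / 3" for s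
      by (simp add: sym_prod_entry y_def b_def d_def scalar_product_def sum_distrib_left
          sum_divide_distrib sum.distrib algebra_simps add_divide_distrib)
    have "flat_A (linear_times_quadric m a) x $ j $ k =
        (\<Sum>i\<in>UNIV. \<Sum>s=1..m. x $ i * sym_prod (a 1) (a s) (a s) $ i $ j $ k)"
      by (simp add: flat_A_def linear_times_quadric_def sum_distrib_left)
    also have "\<dots> = (\<Sum>s=1..m. (y 1 * b s * d s + y s * b 1 * d s + y s * b s * d 1) / 3)"
      by (subst sum.swap) (simp only: one)
    also have "\<dots> = y 1 * b 1 * d 1
        + (\<Sum>s=2..m. (y 1 * b s * d s + y s * b 1 * d s + y s * b s * d 1) / 3)"
      by (subst split) simp
    finally have lhs: "flat_A (linear_times_quadric m a) x $ j $ k = \<dots>" .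
    have row1: "(\<Sum>q=1..m. D 1 q * f 1 $ j * f q $ k) =
        y 1 * b 1 * d 1 + (\<Sum>q=2..m. y q * b 1 * d q / 3)"
    proof -
      have "(\<Sum>q=2..m. D 1 q * f 1 $ j * f q $ k) = (\<Sum>q=2..m. (\<sigma> * \<sigma>) * (y q * b 1 * d q))"
        by (rule sum.cong) (auto simp: D_def arrow_entry_def f_def b_def d_def)
      then show ?thesis
        by (subst split) (simp add: \<sigma> D_def arrow_entry_def f_def b_def d_def)
    qed
    have row: "(\<Sum>q=1..m. D p q * f p $ j * f q $ k) = (y p * b p * d 1 + y 1 * b p * d p) / 3"
      if p: "p \<in> {2..m}" for p
    proof -
      have tail: "(\<Sum>q=2..m. D p q * f p $ j * f q $ k) =
          (\<Sum>q=2..m. if p = q then (\<sigma> * \<sigma>) * (y 1 * b p * d p) else 0)"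
        by (rule sum.cong) (use p in \<open>auto simp: D_def arrow_entry_def f_def b_def d_def\<close>)
      have head: "D p 1 * f p $ j * f 1 $ k = (\<sigma> * \<sigma>) * (y p * b p * d 1)"
        using p by (auto simp: D_def arrow_entry_def f_def b_def d_def)
      show ?thesis
        unfolding split head tail \<sigma> using p by (simp add: add_divide_distrib)
    qed
    have "matrix_in_bases m f f D $ j $ k = (\<Sum>p=1..m. \<Sum>q=1..m. D p q * f p $ j * f q $ k)"
      by (simp add: matrix_in_bases_def)
    also have "\<dots> = y 1 * b 1 * d 1 + (\<Sum>q=2..m. y q * b 1 * d q / 3)
        + (\<Sum>p=2..m. (y p * b p * d 1 + y 1 * b p * d p) / 3)"
      by (subst split) (simp only: row1 row cong: sum.cong)
    also have "\<dots> = flat_A (linear_times_quadric m a) x $ j $ k"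
      unfolding lhs by (simp add: sum.distrib add_divide_distrib algebra_simps)
    finally show ?thesis by simp
  qed
  then show ?thesis by (simp add: vec_eq_iff D_def y_def)
qed

text \<open>The parameters of the arrow matrix are nonzero multiples of the values
  \<open>scalar_product (a j) x\<close>; since \<open>a\<close> is a basis, a combination of dual
  vectors realises any prescribed values.\<close>

lemma range_flat_A_linear_times_quadric:
  fixes a :: "nat \<Rightarrow> complex^'n::finite"
  assumes a: "is_basis {1..m} a" and m: "1 \<le> m"
  obtains f where "is_basis {1..m} f"
    "range (flat_A (linear_times_quadric m a)) = range (\<lambda>x. matrix_in_bases m f f (arrow_entry x))"
proof -
  define \<sigma> where "\<sigma> = csqrt (1 / 3)"
  have \<sigma>: "\<sigma> * \<sigma> = 1 / 3"
    unfolding \<sigma>_def power2_eq_square[symmetric] by (rule power2_csqrt)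
  then have "\<sigma> \<noteq> 0" by auto
  define w where "w j = (if j = 1 then 1 else \<sigma>)" for j :: nat
  define f where "f j = w j *s a j" for j
  have w: "w j \<noteq> 0" for j using \<open>\<sigma> \<noteq> 0\<close> by (simp add: w_def)
  have fb: "is_basis {1..m} f"
    unfolding f_def by (rule is_basis_scale[OF a]) (use w in auto)
  have fl: "flat_A (linear_times_quadric m a) x =
      matrix_in_bases m f f (arrow_entry (\<lambda>j. w j * scalar_product (a j) x))" for x
    using flat_A_linear_times_quadric[OF m \<sigma>, of a x] by (simp add: f_def[abs_def] w_def)
  obtain e where dual: "dual_families {1..m} a e" by (rule is_basis_dual[OF a]) auto
  have "\<exists>x. matrix_in_bases m f f (arrow_entry y) = flat_A (linear_times_quadric m a) x" for y
  proof -
    define x where "x = (\<Sum>j\<in>{1..m}. (y j / w j) *s e j)"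
    have "w i * scalar_product (a i) x = y i" if i: "i \<in> {1..m}" for i
    proof -
      have "scalar_product (a i) x = (\<Sum>j\<in>{1..m}. if i = j then y j / w j else 0)"
        unfolding x_def scalar_product_simps
        by (rule sum.cong) (use dual i in \<open>auto simp: dual_families_def\<close>)
      then show ?thesis using i w[of i] by simp
    qed
    then have "arrow_entry (\<lambda>j. w j * scalar_product (a j) x) p q = arrow_entry y p q"
      if "p \<in> {1..m}" "q \<in> {1..m}" for p q
      using that by (auto simp: arrow_entry_def)
    then have "matrix_in_bases m f f (arrow_entry y) = flat_A (linear_times_quadric m a) x"
      unfolding fl matrix_in_bases_def vec_eq_iff vec_lambda_beta
      by (intro allI sum.cong refl) simp
    then show ?thesis by blast
  qed
  then have "range (flat_A (linear_times_quadric m a)) = range (\<lambda>x. matrix_in_bases m f f (arrow_entry x))"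
    using fl by (auto simp: image_iff)
  with fb show thesis by (rule that)
qed

text \<open>The flattening at \<open>e 0\<close> exchanges the coordinates 0 and
  \<open>q + 1\<close> and fixes the others, so it is invertible. Every term has a factor
  \<open>a 0\<close>, so the tensor vanishes on the kernel of \<open>a 0\<close>.\<close>

lemma cw_tilde_tensor_properties:
  fixes a :: "nat \<Rightarrow> complex^'n::finite"
  assumes a: "is_basis {0..q+1} a"
  defines "T \<equiv> cw_tilde_tensor q a a a"
  shows "symmetric_tensor T" "one_generic T" "max_sym_compressible T" "border_rank T = CARD('n)"
proof -
  show sym: "symmetric_tensor T"
    by (simp add: symmetric_tensor_def T_def cw_tilde_tensor_def tensor_prod_def algebra_simps
        sum.distrib)
  obtain e where e: "is_basis {0..q+1} e" and dual: "dual_families {0..q+1} a e"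
    by (rule is_basis_dual[OF a]) auto
  have sp: "scalar_product (a i) (e j) = (if i = j then 1 else 0)" if "i \<le> q+1" "j \<le> q+1" for i j
    using dual that by (auto simp: dual_families_def)
  have card: "q + 2 = CARD('n)" using is_basis_card[OF a] by simp
  have form: "trilinear_form T x y z = trilinear_form (cw_tensor q a a a) x y z
      + scalar_product (a 0) x * scalar_product (a 0) y * scalar_product (a (q+1)) z
      + scalar_product (a 0) x * scalar_product (a (q+1)) y * scalar_product (a 0) z
      + scalar_product (a (q+1)) x * scalar_product (a 0) y * scalar_product (a 0) z" for x y z
    unfolding T_def cw_tilde_tensor_def cw_tensor_def
    by (simp add: trilinear_form_tensor_add trilinear_form_tensor_prod)
  have det: "det (flat_A T (e 0)) \<noteq> 0"
    unfolding det_nonzero_iff_kernel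
  proof (intro allI impI)
    fix z assume "flat_A T (e 0) *v z = 0"
    then have z: "trilinear_form T (e 0) (e k) z = 0" for k
      by (simp add: trilinear_form_flat_A)
    have "trilinear_form T (e 0) (e k) z = (if k = 0 then scalar_product (a (q+1)) z
        else if k = q+1 then scalar_product (a 0) z else scalar_product (a k) z)" if k: "k \<le> q+1" for k
    proof -
      have "(\<Sum>s=1..q. scalar_product (a s) (e k) * scalar_product (a s) z) =
          (\<Sum>s=1..q. if k = s then scalar_product (a s) z else 0)"
        by (rule sum.cong) (use k in \<open>auto simp: sp\<close>)
      moreover have "(\<Sum>s=1..q. scalar_product (a s) (e 0) * g s) = 0" for g
        by (rule sum.neutral) (auto simp: sp)
      ultimately show ?thesis
        using k unfolding form trilinear_form_cw_tensor by (auto simp: sp)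
    qed
    then have "scalar_product (a k) z = 0" if "k \<in> {0..q+1}" for k
      using that z[of k] z[of 0] z[of "q+1"] by (auto split: if_splits)
    then show "z = 0" by (rule scalar_product_eq_0_on_basis[OF a])
  qed
  then show "one_generic T" using one_generic_symmetric[OF sym] by blast
  show "border_rank T = CARD('n)"
    by (rule border_rank_eqI[OF _ det])
      (simp only: T_def card[symmetric] cw_tilde_tensor_border_rank_le)
  \<comment> \<open>\<open>H\<close> contains \<open>q + 1\<close> independent vectors and omits
    \<open>e 0\<close>, which pins its dimension to one less than that of the space.\<close>
  define H where "H = {x. scalar_product (a 0) x = 0}"
  have sub: "vec.subspace H"
    by (auto simp: H_def vec.subspace_def scalar_product_simps)
  have "e ` {1..q+1} \<subseteq> H" by (auto simp: H_def sp)
  moreover have "vec.independent (e ` {1..q+1})"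
    using e by (auto simp: is_basis_def elim!: vec.independent_mono)
  ultimately have "card (e ` {1..q+1}) \<le> vec.dim H"
    by (rule vec.independent_card_le_dim)
  moreover have "inj_on e {1..q+1}" using e by (auto simp: is_basis_def intro: inj_on_subset)
  ultimately have "q + 1 \<le> vec.dim H" by (simp add: card_image)
  moreover have "vec.dim H \<noteq> CARD('n)"
  proof
    assume "vec.dim H = CARD('n)"
    then have "vec.span H = UNIV"
      by (metis vec.dim_eq_full vec_dim_card vec.span_UNIV)
    then have "H = UNIV" using sub by (metis vec.span_eq_iff)
    then have "e 0 \<in> H" by simp
    then show False by (simp add: H_def sp)
  qed
  moreover have "vec.dim H \<le> CARD('n)"
    by (metis vec.dim_subset_UNIV vec_dim_card vec.span_UNIV vec.dim_eq_full)
  ultimately have "hyperplane H" using sub card by (simp add: hyperplane_def)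
  moreover have "\<forall>x\<in>H. \<forall>y\<in>H. \<forall>z\<in>H. trilinear_form T x y z = 0"
    by (auto simp: H_def form trilinear_form_cw_tensor)
  ultimately show "max_sym_compressible T"
    using sym unfolding max_sym_compressible_def by blast
qed

text \<open>The bound \<open>m \<ge> 3\<close> is sharp: for \<open>m = 2\<close> the cubic
  \<open>a_1 (a_1^2 + a_2^2)\<close> has three distinct linear factors, hence is a sum of two cubes,
  of border rank 2 but not isomorphic to the tilde tensor. The guards \<open>m \<ge> 2\<close> keep
  \<open>m-2\<close> from truncating. The last conjunct shows that the tilde tensors do have all the
  properties, so that the uniqueness claim is not empty.\<close>

theorem theorem7p5:
  fixes m :: nat
  assumes m: "m = CARD('n::finite)"
  shows
    "(\<forall>T :: 'n tensor3.
        symmetric_tensor T \<and> one_generic T \<and> max_sym_compressible T \<longrightarrow>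
          (\<exists>a b c. is_basis {0..m-1} a \<and> is_basis {0..m-1} b \<and> is_basis {0..m-1} c
             \<and> tensor_isomorphic T (cw_tensor (m-1) a b c))
        \<or> (m \<ge> 2 \<and> (\<exists>a b c. is_basis {0..m-1} a \<and> is_basis {0..m-1} b \<and> is_basis {0..m-1} c
             \<and> tensor_isomorphic T (cw_tilde_tensor (m-2) a b c)))
        \<or> (\<exists>a. is_basis {1..m} a \<and> tensor_isomorphic T (linear_times_quadric m a)))
     \<and> (\<forall>a :: nat \<Rightarrow> complex^'n. is_basis {1..m} a \<longrightarrow>
          (\<exists>f g. is_basis {1..m} f \<and> is_basis {1..m} g
             \<and> range (flat_A (linear_times_quadric m a))
                 = range (\<lambda>x. matrix_in_bases m f g (arrow_entry x))))
     \<and> (m \<ge> 3 \<longrightarrow> (\<forall>T :: 'n tensor3.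
          symmetric_tensor T \<and> one_generic T \<and> max_sym_compressible T \<and> border_rank T = m \<longrightarrow>
            (\<exists>a b c. is_basis {0..m-1} a \<and> is_basis {0..m-1} b \<and> is_basis {0..m-1} c
               \<and> tensor_isomorphic T (cw_tilde_tensor (m-2) a b c))))
     \<and> (m \<ge> 2 \<longrightarrow> (\<forall>a :: nat \<Rightarrow> complex^'n. is_basis {0..m-1} a \<longrightarrow>
          (let T = cw_tilde_tensor (m-2) a a a in
             symmetric_tensor T \<and> one_generic T \<and> max_sym_compressible T \<and> border_rank T = m)))"
    (is "?classification \<and> ?matrix \<and> ?minimal \<and> ?properties")
proof (intro conjI)
  have m1: "1 \<le> m" using m by (simp add: Suc_le_eq)
  show ?classification
  proof (intro allI impI, elim conjE)
    fix T :: "'n tensor3"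
    assume "symmetric_tensor T" "one_generic T" "max_sym_compressible T"
    then show "(\<exists>a b c. is_basis {0..m-1} a \<and> is_basis {0..m-1} b \<and> is_basis {0..m-1} c
             \<and> tensor_isomorphic T (cw_tensor (m-1) a b c))
        \<or> (m \<ge> 2 \<and> (\<exists>a b c. is_basis {0..m-1} a \<and> is_basis {0..m-1} b \<and> is_basis {0..m-1} c
             \<and> tensor_isomorphic T (cw_tilde_tensor (m-2) a b c)))
        \<or> (\<exists>a. is_basis {1..m} a \<and> tensor_isomorphic T (linear_times_quadric m a))"
    proof (cases rule: generic_compressible_cases)
      case (nondegenerate c a r)
      then have r: "r = m - 1" "r + 1 = m" using m by auto
      show ?thesis
      proof (cases "c = 0")
        case True
        then have "T = cw_tensor (m-1) a a a"
          using nondegenerate(3) r by (simp add: tensor_prod_def vec_eq_iff)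
        then show ?thesis
          using nondegenerate(2) r tensor_isomorphic_refl[of T] by blast
      next
        case False
        obtain a' where "is_basis {1..r+1} a'" "T = linear_times_quadric (r + 1) a'"
          using nondegenerate_linear_times_quadric[OF nondegenerate(2) False] nondegenerate(3) by metis
        then show ?thesis
          using r tensor_isomorphic_refl[of T] by auto
      qed
    next
      case (degenerate a r)
      then have "r = m - 2" "r + 1 = m - 1" "2 \<le> m" using m by auto
      then show ?thesis
        using degenerate(2,3) tensor_isomorphic_refl[of T] by metis
    qed
  qed
  show ?matrix
    using range_flat_A_linear_times_quadric[OF _ m1] by metis
  show ?minimal
  proof (intro allI impI, elim conjE)
    fix T :: "'n tensor3"
    assume m3: "3 \<le> m" and br: "border_rank T = m"
      and "symmetric_tensor T" "one_generic T" "max_sym_compressible T"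
    from this(3-5) show "\<exists>a b c. is_basis {0..m-1} a \<and> is_basis {0..m-1} b \<and> is_basis {0..m-1} c
        \<and> tensor_isomorphic T (cw_tilde_tensor (m-2) a b c)"
    proof (cases rule: generic_compressible_cases)
      case (nondegenerate c a r)
      then show ?thesis
        using nondegenerate_not_border_rank_le[OF nondegenerate(2,1), of c]
          border_rank_closure[of T] br m m3 by auto
    next
      case (degenerate a r)
      then have "r = m - 2" "r + 1 = m - 1" using m by auto
      then show ?thesis
        using degenerate(2,3) tensor_isomorphic_refl[of T] by metis
    qed
  qed
  show ?properties
  proof (intro allI impI)
    fix a :: "nat \<Rightarrow> complex^'n"
    assume m2: "2 \<le> m" and a: "is_basis {0..m-1} a"
    then have "is_basis {0..m-2+1} a" by (simp add: Suc_diff_le numeral_2_eq_2 Suc_diff_Suc)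
    from cw_tilde_tensor_properties[OF this]
    show "let T = cw_tilde_tensor (m-2) a a a in
        symmetric_tensor T \<and> one_generic T \<and> max_sym_compressible T \<and> border_rank T = m"
      by (simp add: Let_def m)
  qed
qed

end
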